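(* Let $(R,\|\cdot\|)$ be a unitary commutative normed $\mathbb{R}$-algebra with $\mathcal{X}_R=\mathrm{Hom}(R,\mathbb{R})$ nonempty, let $d\ge1$ be an integer, and let $L:R\to\mathbb{R}$ be a $\|\cdot\|$-continuous linear functional. If $L(a^{2d})\ge0$ for each $a\in R$, then there exists a Borel measure $\mu$ on $\mathcal{K}_{\|\cdot\|}$ such that $$L(a)=\int_{\mathcal{K}_{\|\cdot\|}}\hat a\,d\mu\qquad\text{for all }a\in R.$$
   Context: A normed $\mathbb{R}$-algebra is an $\mathbb{R}$-algebra with a norm satisfying $\|xy\|\le\|x\|\,\|y\|$ for all $x,y$ (completeness is not assumed). $\mathcal{X}_R=\mathrm{Hom}(R,\mathbb{R})$ is the set of unitary homomorphisms $\alpha:R\to\mathbb{R}$, with the subspace topology inherited from the product topology on $\mathbb{R}^R$. $\mathcal{K}_{\|\cdot\|}$ (the Gelfand spectrum) is the set of all $\|\cdot\|$-continuous $\alpha\in\mathcal{X}_R$, with the subspace topology. For $a\in R$, $\hat a(\alpha)=\alpha(a)$. Borel measures are positive. *)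

theory Defs
  imports "HOL-Analysis.Analysis"
begin

text \<open>
  The linearity clause makes these homomorphisms of real algebras. Requiring only additivity
  would give the same set: the identity is the only unitary ring endomorphism of the reals.
\<close>
definition real_characters :: "('a::{real_algebra_1, comm_ring_1} \<Rightarrow> real) set" where
  "real_characters = {\<alpha>. linear \<alpha> \<and> (\<forall>x y. \<alpha> (x * y) = \<alpha> x * \<alpha> y) \<and> \<alpha> 1 = 1}"

text \<open>
  The sort does not include \<^class>\<open>real_normed_algebra_1\<close>: that class also demands
  \<open>norm 1 = 1\<close>, which is not part of the definition of a normed algebra used here.
\<close>
definition gelfand_spectrum ::
    "('a::{real_normed_algebra, real_algebra_1, comm_ring_1} \<Rightarrow> real) set" where
  "gelfand_spectrum = {\<alpha> \<in> real_characters. continuous_on UNIV \<alpha>}"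

text \<open>
  A Borel measure on a subset \<open>K\<close> of a topological space, for the subspace topology; the
  \<sigma>-algebra is the trace of the ambient Borel \<sigma>-algebra, and \<open>K\<close> itself need not be
  a Borel set. On a function type, \<^const>\<open>borel\<close> refers to the product topology.
\<close>
definition borel_measure_on :: "'b::topological_space set \<Rightarrow> 'b measure \<Rightarrow> bool" where
  "borel_measure_on K \<mu> \<longleftrightarrow> space \<mu> = K \<and> sets \<mu> = sets (restrict_space borel K)"

lemma borel_measure_on_iff_sigma_sets:
  "borel_measure_on K \<mu> \<longleftrightarrow>
    space \<mu> = K \<and> sets \<mu> = sigma_sets K {U. openin (top_of_set K) U}"
proof -
  have "sets (restrict_space borel K) = {(\<lambda>x. x) -` A \<inter> K | A. A \<in> sigma_sets UNIV {S. open S}}"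
    by (auto simp: sets_restrict_space borel_def)
  also have "\<dots> = sigma_sets K {(\<lambda>x. x) -` A \<inter> K | A. A \<in> {S. open S}}"
    by (rule sigma_sets_vimage_commute) simp
  also have "{(\<lambda>x. x) -` A \<inter> K | A. A \<in> {S. open S}} = {U. openin (top_of_set K) U}"
    by (auto simp: openin_open)
  finally have "sets (restrict_space borel K) = sigma_sets K {U. openin (top_of_set K) U}" .
  then show ?thesis by (simp add: borel_measure_on_def)
qed

end

theory Submission
  imports Defs
begin

text \<open>
  Let \<open>C\<close> be the set of all \<open>x\<close> at which every continuous linear functional that is nonnegative on
  \<open>2d\<close>-th powers is nonnegative. As \<open>y \<mapsto> \<phi> (x y)\<close> is again such a functional for \<open>x \<in> C\<close>, the set
  \<open>C\<close> is a semiring. If \<open>a\<close> is small, then \<open>1 + a\<close> is a limit of \<open>2d\<close>-th powers; hence \<open>C\<close> is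
  archimedean, and characters that are nonnegative on \<open>C\<close> are continuous. By the Kadison-Dubois argument
  with maximal \<open>C\<close>-modules, an \<open>a\<close> outside \<open>C\<close> is negative at such a character. So \<open>L a \<ge> 0\<close>
  whenever \<open>a\<close> is nonnegative on the Gelfand spectrum, which is compact. By Stone-Weierstrass, \<open>L\<close>
  extends to a positive functional on the continuous functions there, and the Riesz-Markov
  representation theorem yields the measure.
\<close>

subsection \<open>Roots of elements close to one\<close>

text \<open>Without completeness \<open>1 + a\<close> need not be a \<open>2d\<close>-th power, only
  a limit of such powers. Defining \<open>C\<close> by duality admits these limits at once and makes
  the passage from membership of \<open>a\<close> to \<open>0 \<le> L a\<close> immediate; the price
  is that stability under products has to be proved by twisting functionals. The archimedean
  property stands in for them. Every ring element is a member of \<open>C\<close> minus a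
  nonnegative real, which turns \<open>P \<inter> -P\<close> into an ideal for every
  \<open>C\<close>-module \<open>P\<close>, and the same property bounds the cuts from which the
  values of a character are read off.\<close>

text \<open>The remainder has no linear term, so its Lipschitz constant on a ball is of the order of
  the radius \<open>\<rho>\<close>; a small ball therefore makes it a contraction. The estimates
  involve norms of \<open>z\<close>, \<open>w\<close> and their remainders only, because
  \<open>norm 1\<close> may exceed 1.\<close>

lemma power_remainder_lipschitz:
  "\<exists>c\<ge>0. \<forall>\<rho> (z::'a::{real_normed_algebra, real_algebra_1, comm_ring_1}) w.
     0 \<le> \<rho> \<longrightarrow> \<rho> \<le> 1 \<longrightarrow> norm z \<le> \<rho> \<longrightarrow> norm w \<le> \<rho> \<longrightarrow>
     norm (((1 + z) ^ m - 1 - real m *\<^sub>R z) - ((1 + w) ^ m - 1 - real m *\<^sub>R w)) \<le> c * \<rho> * norm (z - w)"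
proof (induction m)
  case 0
  then show ?case by (intro exI[of _ 0]) simp
next
  case (Suc m)
  then obtain c where c: "c \<ge> 0"
    and lip: "\<And>\<rho> (z::'a) w. 0 \<le> \<rho> \<Longrightarrow> \<rho> \<le> 1 \<Longrightarrow> norm z \<le> \<rho> \<Longrightarrow> norm w \<le> \<rho> \<Longrightarrow>
     norm (((1 + z) ^ m - 1 - real m *\<^sub>R z) - ((1 + w) ^ m - 1 - real m *\<^sub>R w)) \<le> c * \<rho> * norm (z - w)"
    by blast
  \<comment> \<open>Three summands of the expanded difference contribute \<open>c\<close> each,
    where \<open>norm z \<le> \<rho> \<le> 1\<close> absorbs one factor \<open>z\<close>; the two
    quadratic ones contribute \<open>real m\<close> each.\<close>
  show ?case
  proof (intro exI[of _ "3 * c + 2 * real m"] conjI allI impI)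
    show "0 \<le> 3 * c + 2 * real m" using c by simp
  next
    fix \<rho> and z w :: 'a
    assume \<rho>: "0 \<le> \<rho>" "\<rho> \<le> 1" and z: "norm z \<le> \<rho>" and w: "norm w \<le> \<rho>"
    define g :: "'a \<Rightarrow> 'a" where "g = (\<lambda>z. (1 + z) ^ m - 1 - real m *\<^sub>R z)"
    define D where "D = norm (z - w)"
    have D: "D \<ge> 0" by (simp add: D_def)
    have gzw: "norm (g z - g w) \<le> c * \<rho> * D"
      using lip[OF \<rho> z w] by (simp add: g_def D_def)
    have "norm (g w) \<le> c * \<rho> * norm w"
      using lip[OF \<rho> w, of 0] \<rho> by (simp add: g_def)
    also have "\<dots> \<le> c * \<rho> * 1" using c \<rho> w by (intro mult_left_mono) auto
    finally have gw: "norm (g w) \<le> c * \<rho>" by simp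
    have rec: "(1 + z) ^ Suc m - 1 - real (Suc m) *\<^sub>R z = g z + z * g z + real m *\<^sub>R (z * z)" for z
      by (simp add: g_def algebra_simps)
    have "((1 + z) ^ Suc m - 1 - real (Suc m) *\<^sub>R z) - ((1 + w) ^ Suc m - 1 - real (Suc m) *\<^sub>R w)
        = (g z - g w) + (z * (g z - g w) + (z - w) * g w) + real m *\<^sub>R (z * (z - w) + w * (z - w))"
      unfolding rec by (simp add: algebra_simps)
    also have "norm \<dots> \<le> norm (g z - g w) + (norm (z * (g z - g w)) + norm ((z - w) * g w))
        + real m * (norm (z * (z - w)) + norm (w * (z - w)))"
      by (auto intro!: norm_triangle_le add_mono mult_left_mono norm_triangle_ineq)
    also have "\<dots> \<le> c * \<rho> * D + (1 * (c * \<rho> * D) + D * (c * \<rho>)) + real m * (\<rho> * D + \<rho> * D)"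
    proof (intro add_mono mult_left_mono)
      show "norm (z * (g z - g w)) \<le> 1 * (c * \<rho> * D)"
        using order_trans[OF norm_mult_ineq mult_mono[OF order_trans[OF z \<rho>(2)] gzw]] by auto
      show "norm ((z - w) * g w) \<le> D * (c * \<rho>)"
        using order_trans[OF norm_mult_ineq mult_left_mono[OF gw]] D by (auto simp: D_def)
      show "norm (z * (z - w)) \<le> \<rho> * D" "norm (w * (z - w)) \<le> \<rho> * D"
        using order_trans[OF norm_mult_ineq mult_right_mono] z w by (auto simp: D_def)
    qed (use gzw in auto)
    also have "\<dots> = (3 * c + 2 * real m) * \<rho> * norm (z - w)"
      by (simp add: D_def algebra_simps)
    finally show "norm (((1 + z) ^ Suc m - 1 - real (Suc m) *\<^sub>R z) - ((1 + w) ^ Suc m - 1 - real (Suc m) *\<^sub>R w))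
        \<le> (3 * c + 2 * real m) * \<rho> * norm (z - w)" .
  qed
qed

text \<open>
  The approximations come from the simplified Newton iteration for \<open>y ^ m = 1 + a\<close>. Its residuals
  tend to \<open>0\<close> even though, for lack of completeness, the iterates need not converge.
\<close>
lemma near_one_power_approx:
  assumes "m \<ge> 1"
  obtains \<delta> where "\<delta> > 0"
    "\<And>a::'a::{real_normed_algebra, real_algebra_1, comm_ring_1}.
       norm a \<le> \<delta> \<Longrightarrow> \<exists>y. (\<lambda>n. y n ^ m) \<longlonglongrightarrow> 1 + a"
proof -
  obtain c where c: "c \<ge> 0"
    and lip: "\<And>\<rho> (z::'a) w. 0 \<le> \<rho> \<Longrightarrow> \<rho> \<le> 1 \<Longrightarrow> norm z \<le> \<rho> \<Longrightarrow> norm w \<le> \<rho> \<Longrightarrow>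
     norm (((1 + z) ^ m - 1 - real m *\<^sub>R z) - ((1 + w) ^ m - 1 - real m *\<^sub>R w)) \<le> c * \<rho> * norm (z - w)"
    using power_remainder_lipschitz[where 'a='a, of m] by blast
  define g :: "'a \<Rightarrow> 'a" where "g = (\<lambda>z. (1 + z) ^ m - 1 - real m *\<^sub>R z)"
  \<comment> \<open>Small enough for \<open>c * \<rho> \<le> 1/2\<close>, so that \<open>g\<close>
    contracts by one half; the summand 2 keeps \<open>\<rho> \<le> 1\<close> even if
    \<open>c = 0\<close>.\<close>
  define \<rho> where "\<rho> = 1 / (2 * c + 2)"
  have \<rho>: "\<rho> > 0" "\<rho> \<le> 1" "c * \<rho> \<le> 1/2"
    using c by (auto simp: \<rho>_def field_simps)
  have half: "norm (g z - g w) \<le> norm (z - w) / 2" if "norm z \<le> \<rho>" "norm w \<le> \<rho>" for z w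
  proof -
    have "norm (g z - g w) \<le> c * \<rho> * norm (z - w)"
      using lip[of \<rho> z w] that \<rho> by (simp add: g_def)
    also have "\<dots> \<le> 1/2 * norm (z - w)" using \<rho> by (intro mult_right_mono) auto
    finally show ?thesis by simp
  qed
  have g0: "g 0 = 0" by (simp add: g_def)
  have m: "real m > 0" "1 / real m \<le> 1" using assms by auto
  have shrink: "norm ((1 / real m) *\<^sub>R x) \<le> norm x" for x :: 'a
    using m mult_right_mono[OF m(2), of "norm x"] by simp
  show thesis
  proof (rule that[of "\<rho> / 2"])
    show "\<rho> / 2 > 0" using \<rho> by simp
  next
    fix a :: 'a assume a: "norm a \<le> \<rho> / 2"
    \<comment> \<open>A fixed point of \<open>z \<mapsto> (a - g z) / m\<close> would solve
      \<open>(1 + z) ^ m = 1 + a\<close>. The bound \<open>norm a \<le> \<rho> / 2\<close> keeps the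
      iterates in the ball where \<open>g\<close> contracts.\<close>
    define z where "z = rec_nat 0 (\<lambda>_ z. (1 / real m) *\<^sub>R (a - g z))"
    have z0: "z 0 = 0" and zS: "z (Suc n) = (1 / real m) *\<^sub>R (a - g (z n))" for n
      by (simp_all add: z_def)
    have zn: "norm (z n) \<le> \<rho>" for n
    proof (induction n)
      case (Suc n)
      have "norm (g (z n)) \<le> \<rho> / 2"
        using half[OF Suc, of 0] \<rho> Suc by (simp add: g0)
      then have "norm (a - g (z n)) \<le> \<rho>"
        using a norm_triangle_ineq4[of a "g (z n)"] by simp
      then show ?case using shrink[of "a - g (z n)"] by (simp add: zS)
    qed (use \<rho> z0 in simp)
    have step: "norm (z (Suc n) - z n) \<le> (1/2) ^ n * norm (z 1)" for n
    proof (induction n)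
      case (Suc n)
      have "z (Suc (Suc n)) - z (Suc n) = (1 / real m) *\<^sub>R (g (z n) - g (z (Suc n)))"
        unfolding zS[of "Suc n"] zS[of n] by (simp add: scaleR_diff_right zS)
      then have "norm (z (Suc (Suc n)) - z (Suc n)) \<le> norm (g (z n) - g (z (Suc n)))"
        using shrink[of "g (z n) - g (z (Suc n))"] by simp
      also have "\<dots> \<le> norm (z (Suc n) - z n) / 2"
        using half[OF zn zn, of n "Suc n"] by (simp add: norm_minus_commute)
      finally show ?case using Suc by simp
    qed (simp add: z0)
    have lim: "(\<lambda>n. z (Suc n) - z n) \<longlonglongrightarrow> 0"
    proof (rule Lim_null_comparison)
      show "\<forall>\<^sub>F n in sequentially. norm (z (Suc n) - z n) \<le> (1/2) ^ n * norm (z 1)"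
        using step by simp
      show "(\<lambda>n. (1/2::real) ^ n * norm (z 1)) \<longlonglongrightarrow> 0"
        by (intro tendsto_mult_left_zero LIMSEQ_power_zero) simp
    qed
    \<comment> \<open>The residual is exactly \<open>m\<close> times the next increment, so
      vanishing increments suffice.\<close>
    have "(1 + z n) ^ m = 1 + a - real m *\<^sub>R (z (Suc n) - z n)" for n
      using m by (simp add: zS scaleR_diff_right g_def algebra_simps)
    moreover have "(\<lambda>n. 1 + a - real m *\<^sub>R (z (Suc n) - z n)) \<longlonglongrightarrow> 1 + a - real m *\<^sub>R 0"
      by (intro tendsto_intros lim)
    ultimately have "(\<lambda>n. (1 + z n) ^ m) \<longlonglongrightarrow> 1 + a" by simp
    then show "\<exists>y. (\<lambda>n. y n ^ m) \<longlonglongrightarrow> 1 + a"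
      by (rule exI[of _ "\<lambda>n. 1 + z n"])
  qed
qed

subsection \<open>Characters of archimedean semirings\<close>

text \<open>\<open>archimedean\<close>, applied to \<open>x\<close> and to \<open>-x\<close>, bounds
  every element from both sides by reals modulo \<open>M\<close>. Closedness is required along the
  direction \<open>1\<close> only, which is all that cuts by real numbers need.\<close>

locale archimedean_semiring =
  fixes M :: "'a::{real_algebra_1, comm_ring_1} set"
  assumes add: "x \<in> M \<Longrightarrow> y \<in> M \<Longrightarrow> x + y \<in> M"
    and mult: "x \<in> M \<Longrightarrow> y \<in> M \<Longrightarrow> x * y \<in> M"
    and nonneg: "r \<ge> 0 \<Longrightarrow> of_real r \<in> M"
    and archimedean: "\<exists>N>0. of_real N + x \<in> M"
    and closed: "(\<And>\<epsilon>. \<epsilon> > 0 \<Longrightarrow> x + of_real \<epsilon> \<in> M) \<Longrightarrow> x \<in> M"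
begin

section \<open>Proper modules over the semiring and the character of a maximal one\<close>

text \<open>Modules are used instead of larger semirings because adjoining \<open>-b\<close> creates
  only elements \<open>p - b * s\<close>, linear in \<open>b\<close>, whose properness can be
  checked directly.\<close>

definition module_over :: "'a set \<Rightarrow> bool" where
  "module_over P \<longleftrightarrow> M \<subseteq> P \<and> (\<forall>x\<in>P. \<forall>y\<in>P. x + y \<in> P) \<and> (\<forall>m\<in>M. \<forall>x\<in>P. m * x \<in> P)"

definition proper_module :: "'a set \<Rightarrow> bool" where
  "proper_module P \<longleftrightarrow> module_over P \<and> -1 \<notin> P"

lemma module_overD:
  assumes "module_over P"
  shows "m \<in> M \<Longrightarrow> m \<in> P" "x \<in> P \<Longrightarrow> y \<in> P \<Longrightarrow> x + y \<in> P" "m \<in> M \<Longrightarrow> x \<in> P \<Longrightarrow> m * x \<in> P"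
  using assms by (auto simp: module_over_def)

lemma module_of_real:
  assumes "module_over P" "x \<in> P" "r \<ge> 0"
  shows "of_real r * x \<in> P" "of_real r \<in> P" "x + of_real r \<in> P"
  using assms module_overD[OF assms(1)] nonneg by auto

lemma proper_module_of_real:
  assumes "proper_module P" "of_real r \<in> P"
  shows "r \<ge> 0"
proof (rule ccontr)
  assume "\<not> r \<ge> 0"
  then have "of_real (1 / -r) * of_real r \<in> P"
    using assms by (intro module_of_real(1)) (simp_all add: proper_module_def)
  moreover have "of_real (1 / -r) * of_real r = (of_real (-1) :: 'a)"
    unfolding of_real_mult[symmetric] using \<open>\<not> r \<ge> 0\<close> by simp
  ultimately have "of_real (-1) \<in> P" by metis
  then show False using assms by (simp add: proper_module_def)
qed

definition closed_up :: "'a set \<Rightarrow> bool" where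
  "closed_up P \<longleftrightarrow> (\<forall>x. (\<forall>\<epsilon>>0. x + of_real \<epsilon> \<in> P) \<longrightarrow> x \<in> P)"

text \<open>The admissible \<open>r\<close> form a nonempty set bounded above, by
  \<open>archimedean\<close> for \<open>x\<close> and \<open>-x\<close>; closedness of
  \<open>P\<close> lets the supremum be attained. For a maximal \<open>P\<close> this
  \<open>t\<close> is the value of the character at \<open>x\<close>.\<close>

lemma lower_cut:
  assumes P: "proper_module P" "closed_up P"
  obtains t where "x - of_real t \<in> P" "\<And>r. x - of_real r \<in> P \<Longrightarrow> r \<le> t"
proof -
  have mod: "module_over P" using P by (simp add: proper_module_def)
  define A where "A = {r. x - of_real r \<in> P}"
  obtain N where N: "of_real N + x \<in> M" using archimedean by blast
  obtain N' where N': "of_real N' + (- x) \<in> M" using archimedean by blast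
  have ne: "-N \<in> A" using module_overD(1)[OF mod N] by (simp add: A_def add.commute)
  have bdd: "r \<le> N'" if "r \<in> A" for r
  proof -
    have "(of_real N' + (- x)) + (x - of_real r) \<in> P"
      using that by (intro module_overD(2)[OF mod module_overD(1)[OF mod N']]) (simp add: A_def)
    then have "of_real (N' - r) \<in> P" by simp
    from proper_module_of_real[OF P(1) this] show ?thesis by simp
  qed
  then have ba: "bdd_above A" by (auto simp: bdd_above_def)
  have "x - of_real (Sup A) \<in> P"
  proof -
    have "(x - of_real (Sup A)) + of_real \<epsilon> \<in> P" if "\<epsilon> > 0" for \<epsilon>
    proof -
      have "Sup A - \<epsilon> < Sup A" "A \<noteq> {}" using that ne by auto
      then obtain r where r: "r \<in> A" "Sup A - \<epsilon> < r" by (rule less_cSupE)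
      have "(x - of_real r) + of_real (r - (Sup A - \<epsilon>)) \<in> P"
        using r by (intro module_of_real(3)[OF mod]) (simp_all add: A_def)
      then show ?thesis by (simp add: algebra_simps)
    qed
    then show ?thesis using P(2) by (auto simp: closed_up_def)
  qed
  moreover have "r \<le> Sup A" if "x - of_real r \<in> P" for r
    using that ba by (auto simp: A_def intro: cSup_upper)
  ultimately show thesis using that by blast
qed

text \<open>
  If \<open>-1 = p - b * s\<close>, choose \<open>N\<close> with \<open>N - s \<in> M\<close>; then \<open>N * b = 1 + p + b * (N - s)\<close>, so that
  \<open>b - 1/N\<close> lies in \<open>P\<close>, against the choice of \<open>b\<close>.
\<close>
lemma adjoin_boundary_proper:
  assumes P: "proper_module P" and b: "b \<in> P" and boundary: "\<And>r. b - of_real r \<in> P \<Longrightarrow> r \<le> 0"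
  shows "proper_module {p - b * s | p s. p \<in> P \<and> s \<in> M}" (is "proper_module ?Q")
proof -
  have mod: "module_over P" using P by (simp add: proper_module_def)
  note D = module_overD[OF mod]
  have sub: "P \<subseteq> ?Q"
  proof
    fix p assume "p \<in> P"
    moreover have "0 \<in> M" using nonneg[of 0] by simp
    ultimately show "p \<in> ?Q" by (intro CollectI exI[of _ p] exI[of _ 0]) simp
  qed
  have "module_over ?Q"
    unfolding module_over_def
  proof (intro conjI ballI)
    show "M \<subseteq> ?Q" using sub D(1) by blast
  next
    fix x y assume "x \<in> ?Q" "y \<in> ?Q"
    then obtain p s p' s' where "x = p - b * s" "y = p' - b * s'" "p \<in> P" "s \<in> M" "p' \<in> P" "s' \<in> M"
      by blast
    then show "x + y \<in> ?Q"
      by (intro CollectI exI[of _ "p + p'"] exI[of _ "s + s'"]) (auto simp: algebra_simps D add)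
  next
    fix m x assume "m \<in> M" "x \<in> ?Q"
    then obtain p s where "x = p - b * s" "p \<in> P" "s \<in> M" by blast
    then show "m * x \<in> ?Q" using \<open>m \<in> M\<close>
      by (intro CollectI exI[of _ "m * p"] exI[of _ "m * s"]) (auto simp: algebra_simps D mult)
  qed
  moreover have "-1 \<notin> ?Q"
  proof
    assume "-1 \<in> ?Q"
    then obtain p s where e: "-1 = p - b * s" and p: "p \<in> P" and s: "s \<in> M" by blast
    obtain N where N: "N > 0" "of_real N + (-s) \<in> M" using archimedean by blast
    have "p + (of_real N + (-s)) * b \<in> P" using D p N b by blast
    also have "p + (of_real N + (-s)) * b = of_real N * b + (p - b * s)" by (simp add: algebra_simps)
    also have "\<dots> = of_real N * b - 1" unfolding e[symmetric] by simp
    finally have "of_real (1/N) * (of_real N * b - 1) \<in> P"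
      using N by (intro module_of_real[OF mod]) auto
    also have "of_real (1/N) * (of_real N * b - 1) = b - of_real (1/N)"
      using N by (simp add: right_diff_distrib flip: mult.assoc of_real_mult)
    finally show False using boundary[of "1/N"] N by simp
  qed
  ultimately show ?thesis by (simp add: proper_module_def)
qed

text \<open>Makes maximal proper modules closed, as \<open>lower_cut\<close> demands. If
  \<open>-1\<close> were in the closure, the slack \<open>1/2\<close> would put \<open>-1/2\<close>
  into \<open>P\<close>.\<close>

lemma proper_module_closure:
  assumes "proper_module P"
  shows "proper_module {x. \<forall>\<epsilon>>0. x + of_real \<epsilon> \<in> P}" (is "proper_module ?Q")
proof -
  have mod: "module_over P" using assms by (simp add: proper_module_def)
  note D = module_overD[OF mod]
  have "module_over ?Q"
    unfolding module_over_def
  proof (intro conjI ballI)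
    show "M \<subseteq> ?Q" using D(1) module_of_real[OF mod] by auto
  next
    fix x y assume xy: "x \<in> ?Q" "y \<in> ?Q"
    have "x + y + of_real \<epsilon> \<in> P" if "\<epsilon> > 0" for \<epsilon>
    proof -
      have "(x + of_real (\<epsilon>/2)) + (y + of_real (\<epsilon>/2)) \<in> P"
        using xy that by (intro D(2)[of "x + of_real (\<epsilon>/2)" "y + of_real (\<epsilon>/2)"]) simp_all
      also have "(x + of_real (\<epsilon>/2)) + (y + of_real (\<epsilon>/2)) = x + y + of_real (\<epsilon>/2 + \<epsilon>/2)"
        unfolding of_real_add by (simp add: algebra_simps)
      finally show ?thesis by simp
    qed
    then show "x + y \<in> ?Q" by simp
  next
    fix m x assume m: "m \<in> M" and x: "x \<in> ?Q"
    \<comment> \<open>Multiplying a real slack by \<open>m\<close> need not give a real;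
      \<open>m * (\<epsilon>/N)\<close> is topped up to \<open>\<epsilon>\<close> by
      \<open>(\<epsilon>/N) * (N - m)\<close>.\<close>
    obtain N where N: "N > 0" "of_real N + (-m) \<in> M" using archimedean by blast
    have "m * x + of_real \<epsilon> \<in> P" if "\<epsilon> > 0" for \<epsilon>
    proof -
      have "m * (x + of_real (\<epsilon>/N)) + of_real (\<epsilon>/N) * (of_real N + (-m)) \<in> P"
        using x that N(1)
        by (intro D(2)[OF D(3)[OF m]] module_of_real(1)[OF mod D(1)[OF N(2)]]) simp_all
      also have "m * (x + of_real (\<epsilon>/N)) + of_real (\<epsilon>/N) * (of_real N + (-m))
          = m * x + of_real (\<epsilon>/N) * of_real N" by (simp add: algebra_simps)
      also have "\<dots> = m * x + of_real \<epsilon>" using N by (simp flip: of_real_mult)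
      finally show ?thesis .
    qed
    then show "m * x \<in> ?Q" by simp
  qed
  moreover have "-1 \<notin> ?Q"
  proof
    assume "-1 \<in> ?Q"
    then have "-1 + of_real (1/2) \<in> P" by (auto dest: spec[of _ "1/2"])
    also have "-1 + of_real (1/2) = (of_real (-1 + 1/2) :: 'a)" by (simp only: of_real_add of_real_minus of_real_1)
    finally show False using proper_module_of_real[OF assms, of "-1 + 1/2"] by simp
  qed
  ultimately show ?thesis by (simp add: proper_module_def)
qed

lemma maximal_module_exists:
  assumes "proper_module Q"
  obtains P where "proper_module P" "Q \<subseteq> P" "\<And>P'. proper_module P' \<Longrightarrow> P \<subseteq> P' \<Longrightarrow> P' = P"
proof -
  define \<A> where "\<A> = {P. proper_module P \<and> Q \<subseteq> P}"
  have "\<exists>P\<in>\<A>. \<forall>X\<in>\<A>. P \<subseteq> X \<longrightarrow> X = P"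
  proof (rule subset_Zorn_nonempty)
    show "\<A> \<noteq> {}" using assms by (auto simp: \<A>_def)
  next
    fix \<C> assume ne: "\<C> \<noteq> {}" and ch: "subset.chain \<A> \<C>"
    have mem: "proper_module C" "Q \<subseteq> C" if "C \<in> \<C>" for C
      using ch that by (auto simp: subset_chain_def \<A>_def)
    have mod: "module_over C" if "C \<in> \<C>" for C
      using mem(1)[OF that] by (simp add: proper_module_def)
    have "module_over (\<Union>\<C>)"
      unfolding module_over_def
    proof (intro conjI ballI)
      obtain C where "C \<in> \<C>" using ne by blast
      then show "M \<subseteq> \<Union>\<C>" using module_overD(1)[OF mod] by blast
    next
      fix x y assume "x \<in> \<Union>\<C>" "y \<in> \<Union>\<C>"
      then obtain A B where AB: "A \<in> \<C>" "x \<in> A" "B \<in> \<C>" "y \<in> B" by blast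
      then have "A \<subseteq> B \<or> B \<subseteq> A" using ch unfolding subset_chain_def by blast
      then obtain C where C: "C \<in> \<C>" "x \<in> C" "y \<in> C" using AB by blast
      then show "x + y \<in> \<Union>\<C>" using module_overD(2)[OF mod[OF C(1)] C(2,3)] by blast
    next
      fix m x assume "m \<in> M" "x \<in> \<Union>\<C>"
      then show "m * x \<in> \<Union>\<C>" using module_overD(3)[OF mod] by blast
    qed
    moreover have "-1 \<notin> \<Union>\<C>" using mem by (auto simp: proper_module_def)
    ultimately show "\<Union>\<C> \<in> \<A>" using ne mem(2) by (fastforce simp: \<A>_def proper_module_def)
  qed
  then show thesis using that by (force simp: \<A>_def)
qed

text \<open>\<open>I = P \<inter> -P\<close> is an ideal, since any \<open>y\<close> is
  \<open>(N + y) - N\<close> with both terms in \<open>M\<close>. For the lower cut \<open>t\<close>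
  of \<open>x\<close>, adjoining \<open>-(x - t)\<close> leaves \<open>P\<close> proper, so by
  maximality \<open>x - t\<close> lies in \<open>I\<close>. Hence the ring is the sum of the reals
  and \<open>I\<close>, and \<open>\<alpha>\<close> is the projection to the reals.\<close>

lemma maximal_module_character:
  assumes P: "proper_module P" and max: "\<And>P'. proper_module P' \<Longrightarrow> P \<subseteq> P' \<Longrightarrow> P' = P"
  obtains \<alpha> where "\<alpha> \<in> real_characters" "\<And>x. x \<in> P \<Longrightarrow> \<alpha> x \<ge> 0"
proof -
  have mod: "module_over P" using P by (simp add: proper_module_def)
  note D = module_overD[OF mod]
  have "P \<subseteq> {x. \<forall>\<epsilon>>0. x + of_real \<epsilon> \<in> P}" using module_of_real[OF mod] by auto
  then have cl: "closed_up P"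
    using max[OF proper_module_closure[OF P]] by (auto simp: closed_up_def)
  define I where "I = {x. x \<in> P \<and> -x \<in> P}"
  have Iadd: "x + y \<in> I" if "x \<in> I" "y \<in> I" for x y
    using that D(2)[of x y] D(2)[of "-x" "-y"] by (simp add: I_def)
  have Iminus: "-x \<in> I" if "x \<in> I" for x using that by (simp add: I_def)
  have IM: "m * x \<in> I" if "x \<in> I" "m \<in> M" for x m
    using that D(3)[of m x] D(3)[of m "-x"] by (simp add: I_def)
  have Imult: "y * x \<in> I" if x: "x \<in> I" for x y
  proof -
    obtain N where N: "N > 0" "of_real N + y \<in> M" using archimedean by blast
    have "(of_real N + y) * x + - (of_real N * x) \<in> I"
      using x N nonneg[of N] by (intro Iadd Iminus IM) auto
    then show ?thesis by (simp add: algebra_simps)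
  qed
  have ex: "\<exists>t. x - of_real t \<in> I" for x
  proof -
    obtain t where t: "x - of_real t \<in> P" "\<And>r. x - of_real r \<in> P \<Longrightarrow> r \<le> t"
      using lower_cut[OF P cl] by blast
    let ?b = "x - of_real t"
    have "proper_module {p - ?b * s | p s. p \<in> P \<and> s \<in> M}" (is "proper_module ?Q")
    proof (rule adjoin_boundary_proper[OF P t(1)])
      fix r assume "x - of_real t - of_real r \<in> P"
      then have "x - of_real (t + r) \<in> P" by (simp add: algebra_simps)
      from t(2)[OF this] show "r \<le> 0" by simp
    qed
    moreover have 01: "0 \<in> M" "1 \<in> M" using nonneg[of 0] nonneg[of 1] by auto
    have "P \<subseteq> ?Q"
    proof
      fix p assume "p \<in> P"
      then show "p \<in> ?Q" using 01 by (intro CollectI exI[of _ p] exI[of _ 0]) simp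
    qed
    ultimately have "?Q = P" using max by blast
    moreover have "- ?b \<in> ?Q"
      using 01 D(1)[of 0] by (intro CollectI exI[of _ 0] exI[of _ 1]) simp
    ultimately show ?thesis using t(1) by (auto simp: I_def)
  qed
  define \<alpha> where "\<alpha> x = (SOME t. x - of_real t \<in> I)" for x
  have \<alpha>: "x - of_real (\<alpha> x) \<in> I" for x
    unfolding \<alpha>_def by (rule someI_ex[OF ex])
  have uniq: "\<alpha> x = t" if "x - of_real t \<in> I" for x t
  proof -
    have "(x - of_real t) + - (x - of_real (\<alpha> x)) \<in> I" "(x - of_real (\<alpha> x)) + -(x - of_real t) \<in> I"
      by (rule Iadd[OF that Iminus[OF \<alpha>]], rule Iadd[OF \<alpha> Iminus[OF that]])
    then have "of_real (\<alpha> x - t) \<in> P" "of_real (t - \<alpha> x) \<in> P" by (simp_all add: I_def)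
    from this[THEN proper_module_of_real[OF P]] show ?thesis by simp
  qed
  have I0: "0 \<in> I" using nonneg[of 0] D(1) by (simp add: I_def)
  have "linear \<alpha>"
  proof (rule linearI)
    fix x y
    show "\<alpha> (x + y) = \<alpha> x + \<alpha> y"
      by (rule uniq) (use Iadd[OF \<alpha>[of x] \<alpha>[of y]] in \<open>simp add: algebra_simps\<close>)
  next
    fix r x
    show "\<alpha> (r *\<^sub>R x) = r *\<^sub>R \<alpha> x"
      by (rule uniq) (use Imult[OF \<alpha>[of x], of "of_real r"] in \<open>simp add: algebra_simps scaleR_conv_of_real\<close>)
  qed
  \<comment> \<open>\<open>x * y - \<alpha> x * \<alpha> y = x * (y - \<alpha> y) + \<alpha> y * (x
    - \<alpha> x)\<close>, and both terms lie in the ideal.\<close>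
  moreover have "\<alpha> (x * y) = \<alpha> x * \<alpha> y" for x y
    by (rule uniq) (use Iadd[OF Imult[OF \<alpha>[of y], of x] Imult[OF \<alpha>[of x], of "of_real (\<alpha> y)"]]
      in \<open>simp add: algebra_simps\<close>)
  moreover have "\<alpha> 1 = 1" by (rule uniq) (simp add: I0)
  moreover have "\<alpha> x \<ge> 0" if "x \<in> P" for x
  proof -
    have "x + - (x - of_real (\<alpha> x)) \<in> P" using that \<alpha>[of x] by (intro D(2)) (auto simp: I_def)
    then show ?thesis using proper_module_of_real[OF P] by simp
  qed
  ultimately show thesis using that by (auto simp: real_characters_def)
qed

text \<open>Adjoining \<open>-a\<close> would give only \<open>\<alpha> a \<le> 0\<close>. Instead
  \<open>-(a - t)\<close> is adjoined, where \<open>t\<close> is the lower cut of \<open>a\<close>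
  in \<open>M\<close> itself; \<open>t < 0\<close> because \<open>a\<close> is outside
  \<open>M\<close>, and \<open>\<alpha> a \<le> t\<close> is then strict negativity.\<close>

lemma separating_character:
  assumes a: "a \<notin> M"
  obtains \<alpha> where "\<alpha> \<in> real_characters" "\<And>x. x \<in> M \<Longrightarrow> \<alpha> x \<ge> 0" "\<alpha> a < 0"
proof -
  have mod: "module_over M" by (auto simp: module_over_def add mult)
  have "-1 \<notin> M"
  proof
    assume neg: "-1 \<in> M"
    obtain N where N: "N > 0" "of_real N + a \<in> M" using archimedean by blast
    have "(of_real N + a) + of_real N * (-1) \<in> M"
      using N neg nonneg[of N] by (intro add[OF N(2)] mult) simp_all
    with a show False by simp
  qed
  with mod have PM: "proper_module M" by (simp add: proper_module_def)
  have clM: "closed_up M" using closed by (auto simp: closed_up_def)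
  obtain t where t: "a - of_real t \<in> M" "\<And>r. a - of_real r \<in> M \<Longrightarrow> r \<le> t"
    using lower_cut[OF PM clM] by blast
  have "t < 0"
  proof (rule ccontr)
    assume "\<not> t < 0"
    then have "(a - of_real t) + of_real t \<in> M" using t(1) nonneg[of t] by (intro add) simp_all
    with a show False by simp
  qed
  let ?b = "a - of_real t"
  have "proper_module {p - ?b * s | p s. p \<in> M \<and> s \<in> M}" (is "proper_module ?Q")
  proof (rule adjoin_boundary_proper[OF PM t(1)])
    fix r assume "a - of_real t - of_real r \<in> M"
    then have "a - of_real (t + r) \<in> M" by (simp add: algebra_simps)
    from t(2)[OF this] show "r \<le> 0" by simp
  qed
  then obtain P where P: "proper_module P" "?Q \<subseteq> P"
    and max: "\<And>P'. proper_module P' \<Longrightarrow> P \<subseteq> P' \<Longrightarrow> P' = P"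
    using maximal_module_exists by blast
  obtain \<alpha> where \<alpha>: "\<alpha> \<in> real_characters" "\<And>x. x \<in> P \<Longrightarrow> \<alpha> x \<ge> 0"
    using maximal_module_character[OF P(1) max] by blast
  have "- ?b \<in> ?Q"
    using nonneg[of 0] nonneg[of 1] by (intro CollectI exI[of _ 0] exI[of _ 1]) simp
  then have "\<alpha> (- ?b) \<ge> 0" using \<alpha>(2) P(2) by blast
  moreover have lin: "linear \<alpha>" "\<alpha> 1 = 1" using \<alpha>(1) by (auto simp: real_characters_def)
  have "\<alpha> (of_real t) = t" using linear_scale[OF lin(1), of t 1] lin(2) by (simp add: of_real_def)
  ultimately have "\<alpha> a \<le> t" using lin(1) by (simp add: linear_neg linear_diff)
  with \<open>t < 0\<close> have "\<alpha> a < 0" by simp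
  then show thesis
    using that[of \<alpha>] \<alpha> P(1) module_overD(1)[of P] by (auto simp: proper_module_def)
qed

end

subsection \<open>The Riesz-Markov representation theorem\<close>

locale positive_functional =
  fixes X :: "'b topology" and \<Lambda> :: "('b \<Rightarrow> real) \<Rightarrow> real"
  assumes compact: "compact_space X" and Hausdorff: "Hausdorff_space X"
    and add: "continuous_map X euclideanreal f \<Longrightarrow> continuous_map X euclideanreal g \<Longrightarrow>
      \<Lambda> (\<lambda>x. f x + g x) = \<Lambda> f + \<Lambda> g"
    and scale: "continuous_map X euclideanreal f \<Longrightarrow> \<Lambda> (\<lambda>x. c * f x) = c * \<Lambda> f"
    and nonneg: "continuous_map X euclideanreal f \<Longrightarrow> (\<And>x. x \<in> topspace X \<Longrightarrow> 0 \<le> f x) \<Longrightarrow> 0 \<le> \<Lambda> f"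
begin

abbreviation cont :: "('b \<Rightarrow> real) \<Rightarrow> bool" where
  "cont f \<equiv> continuous_map X euclideanreal f"

text \<open>Used in both directions, it shows that \<open>\<Lambda> f\<close> for continuous
  \<open>f\<close> depends only on the values on \<open>topspace X\<close>, although functions are
  defined on the whole type.\<close>

lemma mono:
  assumes "cont f" "cont g" "\<And>x. x \<in> topspace X \<Longrightarrow> f x \<le> g x"
  shows "\<Lambda> f \<le> \<Lambda> g"
proof -
  have c: "cont (\<lambda>x. g x - f x)" using assms by (intro continuous_intros) auto
  have "0 \<le> \<Lambda> (\<lambda>x. g x - f x)" using assms by (intro nonneg[OF c]) simp
  moreover have "\<Lambda> (\<lambda>x. (g x - f x) + f x) = \<Lambda> (\<lambda>x. g x - f x) + \<Lambda> f" by (rule add[OF c assms(1)])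
  ultimately show ?thesis by simp
qed

lemma functional_sum:
  fixes n :: nat
  assumes "\<And>k. k < n \<Longrightarrow> cont (f k)"
  shows "\<Lambda> (\<lambda>x. \<Sum>k<n. f k x) = (\<Sum>k<n. \<Lambda> (f k))"
  using assms
proof (induction n)
  case 0
  show ?case using scale[of "\<lambda>_. 0" 0] by simp
next
  case (Suc n)
  have "\<Lambda> (\<lambda>x. (\<Sum>k<n. f k x) + f n x) = \<Lambda> (\<lambda>x. \<Sum>k<n. f k x) + \<Lambda> (f n)"
    using Suc.prems by (intro add continuous_map_sum) auto
  with Suc show ?case by simp
qed

lemma total_nonneg: "0 \<le> \<Lambda> (\<lambda>_. 1)"
  by (rule nonneg) auto

section \<open>Content of open sets, its outer measure, and measurability of open sets\<close>

text \<open>Vanishing off \<open>U\<close> is easier to verify than having closed support inside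
  \<open>U\<close>; \<open>trim_bump\<close> recovers the latter at an arbitrarily small
  loss.\<close>

definition bumps :: "'b set \<Rightarrow> ('b \<Rightarrow> real) set" where
  "bumps U = {f. cont f \<and> (\<forall>x\<in>topspace X. 0 \<le> f x \<and> f x \<le> 1) \<and> (\<forall>x\<in>topspace X - U. f x = 0)}"

definition content :: "'b set \<Rightarrow> ennreal" where
  "content U = (SUP f\<in>bumps U. ennreal (\<Lambda> f))"

definition outer :: "'b set \<Rightarrow> ennreal" where
  "outer E = (INF U\<in>{U. openin X U \<and> E \<subseteq> U}. content U)"

lemma bumpsD:
  assumes "f \<in> bumps U"
  shows "cont f" "x \<in> topspace X \<Longrightarrow> 0 \<le> f x" "x \<in> topspace X \<Longrightarrow> f x \<le> 1"
    "x \<in> topspace X \<Longrightarrow> x \<notin> U \<Longrightarrow> f x = 0" "0 \<le> \<Lambda> f"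
  using assms by (auto simp: bumps_def intro!: nonneg)

lemma bumpsI:
  assumes "cont f" "\<And>x. x \<in> topspace X \<Longrightarrow> 0 \<le> f x" "\<And>x. x \<in> topspace X \<Longrightarrow> f x \<le> 1"
    "\<And>x. x \<in> topspace X \<Longrightarrow> x \<notin> U \<Longrightarrow> f x = 0"
  shows "f \<in> bumps U"
  using assms by (auto simp: bumps_def)

lemma zero_in_bumps: "(\<lambda>_. 0) \<in> bumps U"
  by (auto simp: bumps_def)

lemma content_upper: "f \<in> bumps U \<Longrightarrow> ennreal (\<Lambda> f) \<le> content U"
  unfolding content_def by (rule SUP_upper)

lemma content_mono: "U \<subseteq> V \<Longrightarrow> content U \<le> content V"
  unfolding content_def by (rule SUP_subset_mono) (auto simp: bumps_def)

lemma content_le_total: "content U \<le> ennreal (\<Lambda> (\<lambda>_. 1))"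
  unfolding content_def by (intro SUP_least ennreal_leI mono) (auto dest: bumpsD)

lemma outer_open: "openin X U \<Longrightarrow> outer U = content U"
  unfolding outer_def by (rule antisym) (auto intro!: INF_lower INF_greatest content_mono)

lemma outer_mono: "E \<subseteq> F \<Longrightarrow> outer E \<le> outer F"
  unfolding outer_def by (rule INF_superset_mono) auto

text \<open>Lowering \<open>f\<close> by \<open>\<epsilon>\<close> and cutting at 0 confines it to
  the closed set \<open>{f \<ge> \<epsilon>}\<close> and costs at most
  \<open>\<epsilon> * \<Lambda> 1\<close>. The \<open>+ 1\<close> in the denominator covers
  \<open>\<Lambda> 1 = 0\<close>.\<close>

lemma trim_bump:
  assumes f: "f \<in> bumps U" and e: "e > 0"
  obtains h C where "closedin X C" "C \<subseteq> U" "h \<in> bumps C" "\<Lambda> f \<le> \<Lambda> h + e"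
proof -
  define \<epsilon> where "\<epsilon> = e / (\<Lambda> (\<lambda>_. 1) + 1)"
  have \<epsilon>: "\<epsilon> > 0" "\<epsilon> * \<Lambda> (\<lambda>_. 1) \<le> e"
    using e total_nonneg by (auto simp: \<epsilon>_def field_simps)
  define h where "h = (\<lambda>x. max 0 (f x - \<epsilon>))"
  define C where "C = {x \<in> topspace X. f x \<in> {\<epsilon>..}}"
  have h: "cont h" unfolding h_def using bumpsD(1)[OF f] by (intro continuous_intros) auto
  show thesis
  proof (rule that)
    show "closedin X C"
      unfolding C_def using bumpsD(1)[OF f] by (intro closedin_continuous_map_preimage) auto
    show "C \<subseteq> U" using bumpsD(4)[OF f] \<epsilon> by (force simp: C_def)
    show "h \<in> bumps C"
    proof (rule bumpsI[OF h])
      fix x assume x: "x \<in> topspace X"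
      show "0 \<le> h x" by (simp add: h_def)
      show "h x \<le> 1" using bumpsD(3)[OF f x] \<epsilon> by (simp add: h_def)
      show "h x = 0" if "x \<notin> C" using that x by (simp add: h_def C_def)
    qed
    have "\<Lambda> f \<le> \<Lambda> (\<lambda>x. h x + \<epsilon> * 1)"
      using h bumpsD(1)[OF f] by (intro mono continuous_intros) (auto simp: h_def)
    also have "\<dots> = \<Lambda> h + \<epsilon> * \<Lambda> (\<lambda>_. 1)"
      using h by (subst add) (auto simp: scale[of "\<lambda>_. 1" \<epsilon>, simplified])
    finally show "\<Lambda> f \<le> \<Lambda> h + e" using \<epsilon> by simp
  qed
qed

text \<open>A Urysohn function \<open>g\<close>, zero off \<open>U\<close> and one on
  \<open>C - V\<close>, splits the trimmed bump into \<open>h * g\<close> and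
  \<open>h * (1 - g)\<close>. The second part vanishes off \<open>V\<close>: outside
  \<open>C\<close> because of \<open>h\<close>, inside because of \<open>g\<close>.\<close>

lemma content_Un:
  assumes U: "openin X U" and V: "openin X V"
  shows "content (U \<union> V) \<le> content U + content V"
  unfolding content_def[of "U \<union> V"]
proof (rule SUP_least, rule ennreal_le_epsilon)
  fix f and e :: real assume f: "f \<in> bumps (U \<union> V)" and e: "0 < e"
  obtain h C where C: "closedin X C" "C \<subseteq> U \<union> V" and h: "h \<in> bumps C" and fh: "\<Lambda> f \<le> \<Lambda> h + e"
    using trim_bump[OF f e] .
  note hD = bumpsD[OF h]
  have nX: "normal_space X"
    using compact Hausdorff by (simp add: compact_Hausdorff_or_regular_imp_normal_space)
  have "closedin X (topspace X - U)" "closedin X (C - V)" "disjnt (topspace X - U) (C - V)"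
    using U V C by (auto simp: disjnt_def)
  then obtain g where g: "continuous_map X (top_of_set {0..1::real}) g"
    "g ` (topspace X - U) \<subseteq> {0}" "g ` (C - V) \<subseteq> {1}"
    using Urysohn_lemma[OF nX, of "topspace X - U" "C - V" 0 1] by auto
  have g01: "0 \<le> g x \<and> g x \<le> 1" if "x \<in> topspace X" for x
    using g(1) that by (auto simp: continuous_map_in_subtopology)
  have gc: "cont g" using g(1) by (auto simp: continuous_map_in_subtopology)
  have 1: "(\<lambda>x. h x * g x) \<in> bumps U"
    using hD gc g01 g(2) by (intro bumpsI continuous_intros) (auto intro!: mult_le_one)
  have 2: "(\<lambda>x. h x * (1 - g x)) \<in> bumps V"
  proof (intro bumpsI)
    fix x assume x: "x \<in> topspace X" "x \<notin> V"
    show "h x * (1 - g x) = 0" using hD(4)[OF x(1)] g(3) x by (cases "x \<in> C") auto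
  qed (use hD gc g01 in \<open>auto intro!: continuous_intros mult_le_one\<close>)
  have "\<Lambda> h = \<Lambda> (\<lambda>x. h x * g x + h x * (1 - g x))" by (simp add: algebra_simps)
  also have "\<dots> = \<Lambda> (\<lambda>x. h x * g x) + \<Lambda> (\<lambda>x. h x * (1 - g x))"
    using bumpsD(1)[OF 1] bumpsD(1)[OF 2] by (rule add)
  finally have "ennreal (\<Lambda> f) \<le> ennreal (\<Lambda> (\<lambda>x. h x * g x) + \<Lambda> (\<lambda>x. h x * (1 - g x)) + e)"
    using fh by (intro ennreal_leI) simp
  also have "\<dots> = ennreal (\<Lambda> (\<lambda>x. h x * g x)) + ennreal (\<Lambda> (\<lambda>x. h x * (1 - g x))) + ennreal e"
    using bumpsD(5)[OF 1] bumpsD(5)[OF 2] e by (simp add: ennreal_plus)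
  also have "\<dots> \<le> content U + content V + ennreal e"
    by (intro add_mono content_upper 1 2 order_refl)
  finally show "ennreal (\<Lambda> f) \<le> content U + content V + ennreal e" .
qed

lemma content_empty: "content {} = 0"
proof -
  have "content {} \<le> 0"
    unfolding content_def
  proof (rule SUP_least)
    fix f assume f: "f \<in> bumps {}"
    have "\<Lambda> f \<le> \<Lambda> (\<lambda>x. 0 * 1)" using bumpsD[OF f] by (intro mono) auto
    also have "\<dots> = 0" using scale[of "\<lambda>_. 1" 0] by simp
    finally show "ennreal (\<Lambda> f) \<le> 0" by (simp add: ennreal_neg)
  qed
  then show ?thesis by simp
qed

lemma content_UN_lessThan:
  assumes "\<And>i. openin X (U i)"
  shows "content (\<Union>i<n::nat. U i) \<le> (\<Sum>i<n. content (U i))"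
proof (induction n)
  case (Suc n)
  have "content (\<Union>i<Suc n. U i) = content ((\<Union>i<n. U i) \<union> U n)"
    by (simp add: lessThan_Suc Un_commute)
  also have "\<dots> \<le> content (\<Union>i<n. U i) + content (U n)"
    using assms by (intro content_Un) auto
  also have "\<dots> \<le> (\<Sum>i<n. content (U i)) + content (U n)" by (intro add_right_mono Suc)
  finally show ?case by simp
qed (simp add: content_empty)

text \<open>The trimmed bump vanishes off a compact set, which finitely many of the
  \<open>U i\<close> cover; this reduces the claim to finite unions.\<close>

lemma content_UN:
  assumes U: "\<And>i::nat. openin X (U i)"
  shows "content (\<Union>i. U i) \<le> (\<Sum>i. content (U i))"
  unfolding content_def[of "\<Union>i. U i"]
proof (rule SUP_least, rule ennreal_le_epsilon)
  fix f and e :: real assume f: "f \<in> bumps (\<Union>i. U i)" and e: "0 < e"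
  obtain h C where C: "closedin X C" "C \<subseteq> (\<Union>i. U i)" and h: "h \<in> bumps C" and fh: "\<Lambda> f \<le> \<Lambda> h + e"
    using trim_bump[OF f e] .
  have "compactin X C" using closedin_compact_space[OF compact C(1)] .
  then obtain \<F> where \<F>: "finite \<F>" "\<F> \<subseteq> range U" "C \<subseteq> \<Union>\<F>"
    using compactinD[of X C "range U"] U C(2) by blast
  then obtain I where I: "finite I" "\<F> = U ` I" by (meson finite_subset_image subset_UNIV)
  obtain n where n: "I \<subseteq> {..<n}" using finite_nat_iff_bounded I by blast
  have "C \<subseteq> (\<Union>i<n. U i)" using \<F>(3) I(2) n by blast
  then have h': "h \<in> bumps (\<Union>i<n. U i)" using h unfolding bumps_def by blast
  have "ennreal (\<Lambda> f) \<le> ennreal (\<Lambda> h) + ennreal e"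
    using fh bumpsD(5)[OF h] e by (metis ennreal_leI ennreal_plus less_imp_le)
  also have "\<dots> \<le> (\<Sum>i<n. content (U i)) + ennreal e"
    by (intro add_right_mono order_trans[OF content_upper[OF h']] content_UN_lessThan U)
  also have "\<dots> \<le> (\<Sum>i. content (U i)) + ennreal e"
    by (intro add_right_mono sum_le_suminf) auto
  finally show "ennreal (\<Lambda> f) \<le> (\<Sum>i. content (U i)) + ennreal e" .
qed

lemma outer_approx:
  assumes "E \<subseteq> topspace X" "e > 0"
  obtains U where "openin X U" "E \<subseteq> U" "content U \<le> outer E + ennreal e"
proof -
  have "outer E \<le> content (topspace X)"
    unfolding outer_def using assms by (intro INF_lower) auto
  then have "outer E < \<infinity>"
    using content_le_total[of "topspace X"] by (simp add: order_le_less_trans)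
  \<comment> \<open>Strict only because \<open>outer E\<close> is finite.\<close>
  then have "outer E < outer E + ennreal e"
    using assms(2) ennreal_add_left_cancel_less[of "outer E" 0 "ennreal e"] by (simp add: less_top[symmetric])
  then show thesis using that unfolding outer_def[of E] INF_less_iff by fastforce
qed

lemma outer_measure_space_outer: "outer_measure_space (Pow (topspace X)) outer"
  unfolding outer_measure_space_def
proof (intro conjI)
  show "positive (Pow (topspace X)) outer"
    by (simp add: positive_def outer_open content_empty)
  show "increasing (Pow (topspace X)) outer"
    by (simp add: increasing_def outer_mono)
  show "countably_subadditive (Pow (topspace X)) outer"
    unfolding countably_subadditive_def
  proof (intro allI impI, rule ennreal_le_epsilon)
    fix A :: "nat \<Rightarrow> 'b set" and e :: real
    assume A: "range A \<subseteq> Pow (topspace X)" and e: "0 < e"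
    have "\<exists>U. openin X U \<and> A i \<subseteq> U \<and> content U \<le> outer (A i) + ennreal (e * (1/2) ^ Suc i)" for i
    proof -
      have "A i \<subseteq> topspace X" "e * (1/2) ^ Suc i > 0" using A e by auto
      then show ?thesis by (rule outer_approx) blast
    qed
    then obtain U where U: "\<And>i. openin X (U i)" "\<And>i. A i \<subseteq> U i"
      "\<And>i. content (U i) \<le> outer (A i) + ennreal (e * (1/2) ^ Suc i)" by metis
    have "outer (\<Union>i. A i) \<le> content (\<Union>i. U i)"
      using U(1,2) unfolding outer_def by (intro INF_lower) blast
    also have "\<dots> \<le> (\<Sum>i. content (U i))" by (rule content_UN[OF U(1)])
    also have "\<dots> \<le> (\<Sum>i. outer (A i) + ennreal (e * (1/2) ^ Suc i))"
      by (intro suminf_le U(3)) auto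
    also have "\<dots> = (\<Sum>i. outer (A i)) + (\<Sum>i. ennreal (e * (1/2) ^ Suc i))"
      by (intro suminf_add[symmetric]) auto
    also have "(\<Sum>i. ennreal (e * (1/2) ^ Suc i)) = ennreal e"
      using sums_mult[OF power_half_series, of e] e by (intro suminf_ennreal_eq) auto
    finally show "outer (\<Union>i. A i) \<le> (\<Sum>i. outer (A i)) + ennreal e" .
  qed
qed

text \<open>A bump of \<open>V \<inter> U\<close> trimmed to a closed \<open>C\<close> leaves the
  open set \<open>V - C\<close>, which contains \<open>V - U\<close>. Any bump of
  \<open>V - C\<close> can be added to it without exceeding 1, since one of the two vanishes at each
  point.\<close>

lemma content_split:
  assumes U: "openin X U" and V: "openin X V"
  shows "content (V \<inter> U) + outer (V - U) \<le> content V"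
proof (rule ennreal_le_epsilon)
  fix e :: real assume e: "0 < e"
  have e2: "e / 2 > 0" using e by simp
  have small: "ennreal (\<Lambda> f) + outer (V - U) \<le> content V + ennreal (e / 2)" if f: "f \<in> bumps (V \<inter> U)" for f
  proof -
    obtain h C where C: "closedin X C" "C \<subseteq> V \<inter> U" and h: "h \<in> bumps C" and fh: "\<Lambda> f \<le> \<Lambda> h + e / 2"
      using trim_bump[OF f e2] .
    have o: "openin X (V - C)" using V C(1) by (rule openin_diff)
    have "outer (V - U) \<le> content (V - C)"
      unfolding outer_open[OF o, symmetric] using C(2) by (intro outer_mono) blast
    also have "ennreal (\<Lambda> h) + content (V - C) \<le> content V"
    proof -
      have "ennreal (\<Lambda> h) + content (V - C) = (SUP g\<in>bumps (V - C). ennreal (\<Lambda> h) + ennreal (\<Lambda> g))"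
        unfolding content_def using zero_in_bumps by (intro ennreal_SUP_add_right) auto
      also have "\<dots> \<le> content V"
      proof (rule SUP_least)
        fix g assume g: "g \<in> bumps (V - C)"
        note hD = bumpsD[OF h] and gD = bumpsD[OF g]
        have "(\<lambda>x. h x + g x) \<in> bumps V"
        proof (rule bumpsI)
          show "cont (\<lambda>x. h x + g x)" using hD(1) gD(1) by (intro continuous_intros) auto
          fix x assume x: "x \<in> topspace X"
          show "0 \<le> h x + g x" using hD(2) gD(2) x by simp
          show "h x + g x \<le> 1" using hD(3,4) gD(3,4) x by (cases "x \<in> C") auto
          show "h x + g x = 0" if "x \<notin> V" using hD(4)[OF x] gD(4)[OF x] that C(2) by auto
        qed
        then show "ennreal (\<Lambda> h) + ennreal (\<Lambda> g) \<le> content V"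
          using content_upper[of "\<lambda>x. h x + g x" V] hD(5) gD(5) by (simp add: add hD(1) gD(1) ennreal_plus)
      qed
      finally show ?thesis .
    qed
    finally have *: "ennreal (\<Lambda> h) + outer (V - U) \<le> content V" by (simp add: add_left_mono)
    have "ennreal (\<Lambda> f) \<le> ennreal (\<Lambda> h) + ennreal (e / 2)"
      using fh bumpsD(5)[OF h] e2 by (metis ennreal_leI ennreal_plus less_imp_le)
    then have "ennreal (\<Lambda> f) + outer (V - U) \<le> (ennreal (\<Lambda> h) + ennreal (e / 2)) + outer (V - U)"
      by (rule add_right_mono)
    also have "\<dots> = (ennreal (\<Lambda> h) + outer (V - U)) + ennreal (e / 2)" by (simp add: ac_simps)
    also have "\<dots> \<le> content V + ennreal (e / 2)" by (rule add_right_mono[OF *])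
    finally show ?thesis .
  qed
  have "content (V \<inter> U) + outer (V - U) = (SUP f\<in>bumps (V \<inter> U). ennreal (\<Lambda> f) + outer (V - U))"
    unfolding content_def
    using zero_in_bumps by (intro ennreal_SUP_add_left[symmetric]) auto
  also have "\<dots> \<le> content V + ennreal (e / 2)" by (intro SUP_least small)
  also have "\<dots> \<le> content V + ennreal e" using e by (intro add_left_mono ennreal_leI) simp
  finally show "content (V \<inter> U) + outer (V - U) \<le> content V + ennreal e" .
qed

text \<open>\<open>content_split\<close> is Caratheodory's inequality for open test sets; the
  infimum defining \<open>outer E\<close> carries it over to arbitrary \<open>E\<close>.\<close>

lemma open_in_lambda_system:
  assumes U: "openin X U"
  shows "U \<in> lambda_system (topspace X) (Pow (topspace X)) outer"
proof -
  interpret P: sigma_algebra "topspace X" "Pow (topspace X)" by (rule sigma_algebra_Pow)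
  have U': "U \<subseteq> topspace X" using U by (rule openin_subset)
  have "outer (E \<inter> U) + outer (E - U) = outer E" if E: "E \<subseteq> topspace X" for E
  proof (rule antisym)
    show "outer (E \<inter> U) + outer (E - U) \<le> outer E"
      unfolding outer_def[of E]
    proof (rule INF_greatest, clarify)
      fix V assume V: "openin X V" "E \<subseteq> V"
      have "outer (E \<inter> U) + outer (E - U) \<le> outer (V \<inter> U) + outer (V - U)"
        using V(2) by (intro add_mono outer_mono) auto
      also have "\<dots> \<le> content V"
        using content_split[OF U V(1)] U V(1) by (simp add: outer_open openin_Int)
      finally show "outer (E \<inter> U) + outer (E - U) \<le> content V" .
    qed
    have "subadditive (Pow (topspace X)) outer"
      using outer_measure_space_outer
      by (intro P.countably_subadditive_subadditive) (auto simp: outer_measure_space_def)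
    then have "outer ((E \<inter> U) \<union> (E - U)) \<le> outer (E \<inter> U) + outer (E - U)"
      using E by (intro subadditiveD[of "Pow (topspace X)"]) auto
    then show "outer E \<le> outer (E \<inter> U) + outer (E - U)" by (simp add: Int_Diff_Un)
  qed
  then show ?thesis using U' by (simp add: P.lambda_system_eq)
qed

section \<open>The representing measure and its integral\<close>

text \<open>\<open>measure_of\<close> takes the values of \<open>outer\<close> only if they form a
  measure on the generated sigma-algebra; Caratheodory's lemma, restricted to that sigma-algebra,
  secures this in \<open>emeasure_open\<close>.\<close>

definition representing_measure :: "'b measure" where
  "representing_measure = measure_of (topspace X) {U. openin X U} outer"

lemma space_representing_measure: "space representing_measure = topspace X"
  unfolding representing_measure_def by (rule space_measure_of) (auto dest: openin_subset)

lemma sets_representing_measure: "sets representing_measure = sigma_sets (topspace X) {U. openin X U}"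
  unfolding representing_measure_def by (rule sets_measure_of) (auto dest: openin_subset)

lemma emeasure_open:
  assumes U: "openin X U"
  shows "emeasure representing_measure U = content U"
proof -
  let ?L = "lambda_system (topspace X) (Pow (topspace X)) outer"
  have L: "measure_space (topspace X) ?L outer"
    by (rule sigma_algebra.caratheodory_lemma[OF sigma_algebra_Pow outer_measure_space_outer])
  have "sigma_sets (topspace X) {U. openin X U} \<subseteq> ?L"
    using L open_in_lambda_system
    by (intro sigma_algebra.sigma_sets_subset) (auto simp: measure_space_def)
  then have "measure_space (topspace X) (sigma_sets (topspace X) {U. openin X U}) outer"
    by (intro measure_down[OF L] sigma_algebra_sigma_sets) (auto dest: openin_subset)
  then have "emeasure representing_measure U = outer U"
    using U by (intro emeasure_measure_of[OF representing_measure_def])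
      (auto simp: measure_space_def sets_representing_measure dest: openin_subset)
  then show ?thesis using U by (simp add: outer_open)
qed

lemma emeasure_topspace: "emeasure representing_measure (topspace X) = ennreal (\<Lambda> (\<lambda>_. 1))"
  using content_le_total[of "topspace X"] content_upper[of "\<lambda>_. 1" "topspace X"]
  by (simp add: emeasure_open bumps_def)

lemma finite_measure_representing: "finite_measure representing_measure"
  by (rule finite_measureI) (simp add: space_representing_measure emeasure_topspace)

lemma open_in_sets: "openin X U \<Longrightarrow> U \<in> sets representing_measure"
  by (simp add: sets_representing_measure)

lemma bump_le_measure:
  assumes "openin X U" "f \<in> bumps U"
  shows "\<Lambda> f \<le> measure representing_measure U"
proof -
  interpret finite_measure representing_measure by (rule finite_measure_representing)
  show ?thesis
    using content_upper[OF assms(2)] emeasure_open[OF assms(1)] bumpsD(5)[OF assms(2)]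
    by (metis emeasure_eq_measure ennreal_le_iff measure_nonneg)
qed

lemma cont_measurable:
  assumes "cont f"
  shows "f \<in> borel_measurable representing_measure"
proof (rule borel_measurableI)
  fix S :: "real set" assume "open S"
  then have "openin X {x \<in> topspace X. f x \<in> S}"
    using assms by (intro openin_continuous_map_preimage) auto
  moreover have "f -` S \<inter> space representing_measure = {x \<in> topspace X. f x \<in> S}"
    by (auto simp: space_representing_measure)
  ultimately show "f -` S \<inter> space representing_measure \<in> sets representing_measure"
    by (simp add: open_in_sets)
qed

lemma cont_bounded:
  assumes "cont f"
  obtains B where "B > 0" "\<And>x. x \<in> topspace X \<Longrightarrow> \<bar>f x\<bar> \<le> B"
proof -
  have "compactin euclideanreal (f ` topspace X)"
    using compact assms by (intro image_compactin) (auto simp: compact_space_def)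
  then have "bounded (f ` topspace X)" by (simp add: compact_imp_bounded)
  then show thesis using that by (auto simp: bounded_pos)
qed

lemma cont_integrable:
  assumes "cont f"
  shows "integrable representing_measure f"
proof -
  interpret finite_measure representing_measure by (rule finite_measure_representing)
  obtain B where "\<And>x. x \<in> topspace X \<Longrightarrow> \<bar>f x\<bar> \<le> B" using cont_bounded[OF assms] by blast
  then show ?thesis
    by (intro integrable_const_bound[of _ B]) (auto simp: space_representing_measure cont_measurable[OF assms])
qed

text \<open>
  The layers \<open>min 1 (max 0 (n f - k))\<close> for \<open>k < n\<close> add up to \<open>n f\<close>, and the \<open>k\<close>-th one lies between
  the indicators of \<open>{f > (k + 1)/n}\<close> and \<open>{f > k/n}\<close>.
\<close>
lemma functional_le_integral_unit:
  assumes f: "cont f" and f01: "\<And>x. x \<in> topspace X \<Longrightarrow> 0 \<le> f x \<and> f x \<le> 1"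
  shows "\<Lambda> f \<le> (\<integral>x. f x \<partial>representing_measure)"
proof -
  let ?\<mu> = representing_measure
  interpret finite_measure ?\<mu> by (rule finite_measure_representing)
  define T where "T = measure ?\<mu> (topspace X)"
  \<comment> \<open>Comparing \<open>U k\<close> with \<open>U (Suc k)\<close> shifts the sum by one
    index and costs a single \<open>measure (U 0) \<le> T\<close>, independent of \<open>n\<close>;
    after division by \<open>n\<close> the error tends to 0.\<close>
  have approx: "real n * \<Lambda> f \<le> T + real n * (\<integral>x. f x \<partial>?\<mu>)" for n
  proof -
    define h where "h k x = min 1 (max 0 (real n * f x - real k))" for k x
    define U where "U k = {x \<in> topspace X. real n * f x \<in> {real k<..}}" for k
    have hc: "cont (h k)" for k unfolding h_def using f by (intro continuous_intros) auto
    have Uo: "openin X (U k)" for k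
      unfolding U_def
      by (rule openin_continuous_map_preimage[where Y=euclideanreal]) (use f in \<open>auto intro!: continuous_intros\<close>)
    have hb: "h k \<in> bumps (U k)" for k
      by (intro bumpsI hc) (auto simp: h_def U_def)
    have low: "measure ?\<mu> (U (Suc k)) \<le> (\<integral>x. h k x \<partial>?\<mu>)" for k
    proof -
      have "measure ?\<mu> (U (Suc k)) = (\<integral>x. indicator (U (Suc k)) x \<partial>?\<mu>)"
        using openin_subset[OF Uo] by (simp add: space_representing_measure Int_absorb2)
      also have "\<dots> \<le> (\<integral>x. h k x \<partial>?\<mu>)"
      proof (rule integral_mono)
        show "integrable ?\<mu> (indicator (U (Suc k)) :: 'b \<Rightarrow> real)"
          using open_in_sets[OF Uo] by (simp add: less_top[symmetric])
        show "integrable ?\<mu> (h k)" by (rule cont_integrable[OF hc])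
      qed (auto simp: h_def U_def indicator_def)
      finally show ?thesis .
    qed
    \<comment> \<open>If \<open>y \<le> n'\<close>, the last layer is zero; otherwise all earlier
      layers are full.\<close>
    have layers: "(\<Sum>k<n'. min 1 (max 0 (y - real k))) = y" if "0 \<le> y" "y \<le> real n'" for n' y
      using that
    proof (induction n' arbitrary: y)
      case (Suc n')
      show ?case
      proof (cases "y \<le> real n'")
        case True
        then show ?thesis using Suc by simp
      next
        case False
        then have "(\<Sum>k<n'. min 1 (max 0 (y - real k))) = (\<Sum>k<n'. 1)" by (intro sum.cong) auto
        then show ?thesis using False Suc.prems by simp
      qed
    qed simp
    have eq: "(\<Sum>k<n. h k x) = real n * f x" if "x \<in> topspace X" for x
      unfolding h_def using f01[OF that] by (intro layers) (auto simp: mult_left_le)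
    have "real n * \<Lambda> f = \<Lambda> (\<lambda>x. real n * f x)" using scale[OF f] by simp
    also have "\<dots> \<le> \<Lambda> (\<lambda>x. \<Sum>k<n. h k x)"
      using f hc eq by (intro mono continuous_intros) auto
    also have "\<dots> = (\<Sum>k<n. \<Lambda> (h k))" by (intro functional_sum hc)
    also have "\<dots> \<le> (\<Sum>k<n. measure ?\<mu> (U k))" by (intro sum_mono bump_le_measure Uo hb)
    also have "\<dots> \<le> measure ?\<mu> (U 0) + (\<Sum>k<n. measure ?\<mu> (U (Suc k)))"
      using sum.lessThan_Suc[of "\<lambda>k. measure ?\<mu> (U k)" n] sum.lessThan_Suc_shift[of "\<lambda>k. measure ?\<mu> (U k)" n]
        measure_nonneg[of ?\<mu> "U n"] by linarith
    also have "\<dots> \<le> T + (\<Sum>k<n. \<integral>x. h k x \<partial>?\<mu>)"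
      unfolding T_def using open_in_sets[of "topspace X"]
      by (intro add_mono finite_measure_mono sum_mono low) (auto simp: U_def)
    also have "(\<Sum>k<n. \<integral>x. h k x \<partial>?\<mu>) = (\<integral>x. (\<Sum>k<n. h k x) \<partial>?\<mu>)"
      using hc by (intro Bochner_Integration.integral_sum[symmetric] cont_integrable)
    also have "\<dots> = (\<integral>x. real n * f x \<partial>?\<mu>)"
      using eq by (intro Bochner_Integration.integral_cong) (auto simp: space_representing_measure)
    finally show ?thesis by simp
  qed
  show ?thesis
  proof (rule field_le_epsilon)
    fix e :: real assume e: "0 < e"
    obtain n where n: "T / e < real n" using reals_Archimedean2 by blast
    have "T \<ge> 0" by (simp add: T_def)
    then have "n > 0" using n e by (metis divide_nonneg_pos gr0I not_less of_nat_0)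
    have "real n * \<Lambda> f \<le> real n * ((\<integral>x. f x \<partial>?\<mu>) + e)"
      using approx[of n] n e by (simp add: field_simps)
    then show "\<Lambda> f \<le> (\<integral>x. f x \<partial>?\<mu>) + e" using \<open>n > 0\<close> by simp
  qed
qed

text \<open>One inequality for all continuous functions suffices, by passing to \<open>-f\<close>.
  An affine change of \<open>g\<close> moves its values into \<open>[0, 1]\<close>; the added
  constant cancels because the total mass is exactly \<open>\<Lambda> 1\<close>.\<close>

lemma functional_eq_integral:
  assumes f: "cont f"
  shows "\<Lambda> f = (\<integral>x. f x \<partial>representing_measure)"
proof -
  let ?\<mu> = representing_measure
  interpret finite_measure ?\<mu> by (rule finite_measure_representing)
  have total: "(\<integral>x. 1 \<partial>?\<mu>) = \<Lambda> (\<lambda>_. 1)"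
    using emeasure_topspace total_nonneg by (simp add: space_representing_measure measure_def)
  have le: "\<Lambda> g \<le> (\<integral>x. g x \<partial>?\<mu>)" if g: "cont g" for g
  proof -
    obtain B where B: "B > 0" "\<And>x. x \<in> topspace X \<Longrightarrow> \<bar>g x\<bar> \<le> B" using cont_bounded[OF g] by blast
    define h where "h = (\<lambda>x. 1 / (2 * B) * (g x + B * 1))"
    have h: "cont h" unfolding h_def using g by (intro continuous_intros) auto
    have "0 \<le> h x \<and> h x \<le> 1" if "x \<in> topspace X" for x
      using B(1) B(2)[OF that] by (auto simp: h_def field_simps)
    from functional_le_integral_unit[OF h this]
    have "\<Lambda> h \<le> (\<integral>x. h x \<partial>?\<mu>)" by blast
    moreover have "\<Lambda> h = 1 / (2 * B) * (\<Lambda> g + B * \<Lambda> (\<lambda>_. 1))"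
      unfolding h_def using g by (subst scale, (intro continuous_intros; simp), subst add) (auto simp: scale[of "\<lambda>_. 1" B, simplified])
    moreover have "(\<integral>x. h x \<partial>?\<mu>) = 1 / (2 * B) * ((\<integral>x. g x \<partial>?\<mu>) + B * (\<integral>x. 1 \<partial>?\<mu>))"
      unfolding h_def using cont_integrable[OF g] by simp
    ultimately show ?thesis using B(1) total by (simp add: field_simps)
  qed
  have "cont (\<lambda>x. -1 * f x)" using f by (intro continuous_intros) auto
  from le[OF this] have "- \<Lambda> f \<le> - (\<integral>x. f x \<partial>?\<mu>)" unfolding scale[OF f] by simp
  with le[OF f] show ?thesis by simp
qed

end

subsection \<open>Continuous functionals that are nonnegative on even powers\<close>

definition even_power_functional :: "nat \<Rightarrow> ('a::{real_normed_algebra, real_algebra_1, comm_ring_1} \<Rightarrow> real) \<Rightarrow> bool" where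
  "even_power_functional d \<phi> \<longleftrightarrow> linear \<phi> \<and> continuous_on UNIV \<phi> \<and> (\<forall>a. 0 \<le> \<phi> (a ^ (2 * d)))"

text \<open>For \<open>d \<ge> 1\<close> this is, by the bipolar theorem, the norm closure of the
  sums of \<open>2d\<close>-th powers.\<close>

definition even_power_cone :: "nat \<Rightarrow> 'a::{real_normed_algebra, real_algebra_1, comm_ring_1} set" where
  "even_power_cone d = {x. \<forall>\<phi>. even_power_functional d \<phi> \<longrightarrow> 0 \<le> \<phi> x}"

lemma linear_of_real:
  fixes \<phi> :: "'a::{real_algebra_1} \<Rightarrow> real"
  assumes "linear \<phi>"
  shows "\<phi> (of_real r) = r * \<phi> 1"
  using linear_scale[OF assms, of r 1] by (simp add: of_real_def)

lemma near_one_in_even_power_cone: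
  assumes "d \<ge> 1"
  obtains \<delta> where "\<delta> > 0"
    "\<And>a::'a::{real_normed_algebra, real_algebra_1, comm_ring_1}. norm a \<le> \<delta> \<Longrightarrow> 1 + a \<in> even_power_cone d"
proof -
  obtain \<delta> where \<delta>: "\<delta> > 0"
    "\<And>a::'a. norm a \<le> \<delta> \<Longrightarrow> \<exists>y. (\<lambda>n. y n ^ (2 * d)) \<longlonglongrightarrow> 1 + a"
    using near_one_power_approx[where 'a='a, of "2 * d"] assms by auto
  show thesis
  proof (rule that[OF \<delta>(1)])
    fix a :: 'a assume "norm a \<le> \<delta>"
    then obtain y where y: "(\<lambda>n. y n ^ (2 * d)) \<longlonglongrightarrow> 1 + a" using \<delta>(2) by blast
    have "0 \<le> \<phi> (1 + a)" if \<phi>: "even_power_functional d \<phi>" for \<phi>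
    proof (rule LIMSEQ_le_const)
      show "(\<lambda>n. \<phi> (y n ^ (2 * d))) \<longlonglongrightarrow> \<phi> (1 + a)"
        using \<phi> by (intro continuous_on_tendsto_compose[OF _ y]) (auto simp: even_power_functional_def)
    qed (use \<phi> in \<open>auto simp: even_power_functional_def\<close>)
    then show "1 + a \<in> even_power_cone d" by (simp add: even_power_cone_def)
  qed
qed

text \<open>Two rounds of twisting: for \<open>x = a ^ (2 * d)\<close> the claim is multiplicativity
  of powers. The functional \<open>y \<mapsto> \<phi> (a ^ (2 * d) * y)\<close> is thus admissible,
  and testing a general \<open>x\<close> against it gives the rest.\<close>

lemma even_power_functional_mult:
  assumes "even_power_functional d \<phi>" "x \<in> even_power_cone d"
  shows "even_power_functional d (\<lambda>y. \<phi> (x * y))"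
proof -
  have \<phi>: "linear \<phi>" "continuous_on UNIV \<phi>" "\<And>a. 0 \<le> \<phi> (a ^ (2 * d))"
    using assms(1) by (auto simp: even_power_functional_def)
  have lin: "linear (\<lambda>y. \<phi> (z * y))" and cont: "continuous_on UNIV (\<lambda>y. \<phi> (z * y))" for z
    using \<phi>(1) by (auto simp: linear_iff algebra_simps
      intro!: continuous_on_compose2[OF \<phi>(2)] continuous_intros)
  have "0 \<le> \<phi> (x * a ^ (2 * d))" for a
  proof -
    have "0 \<le> \<phi> (a ^ (2 * d) * b ^ (2 * d))" for b
      using \<phi>(3)[of "a * b"] by (simp add: power_mult_distrib)
    then have "even_power_functional d (\<lambda>y. \<phi> (a ^ (2 * d) * y))"
      using lin cont by (auto simp: even_power_functional_def)
    then show ?thesis using assms(2) by (auto simp: even_power_cone_def mult.commute)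
  qed
  then show ?thesis using lin cont by (auto simp: even_power_functional_def)
qed

lemma archimedean_semiring_even_power_cone:
  assumes "d \<ge> 1"
  shows "archimedean_semiring (even_power_cone d :: 'a::{real_normed_algebra, real_algebra_1, comm_ring_1} set)"
proof
  fix x y :: 'a
  assume x: "x \<in> even_power_cone d" and y: "y \<in> even_power_cone d"
  show "x + y \<in> even_power_cone d"
    using x y by (auto simp: even_power_cone_def even_power_functional_def linear_add)
  show "x * y \<in> even_power_cone d"
    using even_power_functional_mult[OF _ x] y by (auto simp: even_power_cone_def)
next
  fix r :: real assume "r \<ge> 0"
  have "0 \<le> \<phi> (of_real r)" if "even_power_functional d \<phi>" for \<phi> :: "'a \<Rightarrow> real"
  proof -
    have "linear \<phi>" and "0 \<le> \<phi> (1 ^ (2 * d))" using that unfolding even_power_functional_def by blast+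
    then show ?thesis using \<open>r \<ge> 0\<close> by (simp add: linear_of_real)
  qed
  then show "(of_real r :: 'a) \<in> even_power_cone d" by (simp add: even_power_cone_def)
next
  fix x :: 'a
  obtain \<delta> where \<delta>: "\<delta> > 0" "\<And>a::'a. norm a \<le> \<delta> \<Longrightarrow> 1 + a \<in> even_power_cone d"
    by (rule near_one_in_even_power_cone[where 'a='a, OF assms]) blast
  \<comment> \<open>Scales \<open>x\<close> into the \<open>\<delta>\<close>-ball; the
    \<open>+ 1\<close> keeps \<open>N\<close> positive for \<open>x = 0\<close>.\<close>
  define N where "N = norm x / \<delta> + 1"
  have N: "N > 0" using \<delta>(1) by (simp add: N_def add_nonneg_pos)
  have "norm ((1 / N) *\<^sub>R x) \<le> \<delta>" using \<delta>(1) N by (simp add: N_def field_simps)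
  then have c: "1 + (1 / N) *\<^sub>R x \<in> even_power_cone d" by (rule \<delta>(2))
  have "of_real N + x \<in> even_power_cone d"
    unfolding even_power_cone_def
  proof (intro CollectI allI impI)
    fix \<phi> :: "'a \<Rightarrow> real" assume \<phi>: "even_power_functional d \<phi>"
    have "of_real N + x = N *\<^sub>R (1 + (1 / N) *\<^sub>R x)" using N by (simp add: of_real_def algebra_simps)
    then have "\<phi> (of_real N + x) = N * \<phi> (1 + (1 / N) *\<^sub>R x)"
      using \<phi> linear_scale[of \<phi> N] by (simp add: even_power_functional_def)
    then show "0 \<le> \<phi> (of_real N + x)" using c \<phi> N by (simp add: even_power_cone_def)
  qed
  then show "\<exists>N>0. of_real N + x \<in> even_power_cone d" using N by blast
next
  fix x :: 'a assume x: "\<And>\<epsilon>. \<epsilon> > 0 \<Longrightarrow> x + of_real \<epsilon> \<in> even_power_cone d"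
  have "0 \<le> \<phi> x" if \<phi>: "even_power_functional d \<phi>" for \<phi>
  proof (rule field_le_epsilon)
    fix e :: real assume e: "0 < e"
    have lin: "linear \<phi>" using \<phi> by (simp add: even_power_functional_def)
    define \<epsilon> where "\<epsilon> = e / (\<bar>\<phi> 1\<bar> + 1)"
    have "\<epsilon> > 0" using e by (simp add: \<epsilon>_def)
    then have "0 \<le> \<phi> (x + of_real \<epsilon>)" using x[of \<epsilon>] \<phi> by (simp add: even_power_cone_def)
    also have "\<dots> = \<phi> x + \<epsilon> * \<phi> 1" using lin by (simp add: linear_add linear_of_real)
    also have "\<epsilon> * \<phi> 1 \<le> \<epsilon> * (\<bar>\<phi> 1\<bar> + 1)" using \<open>\<epsilon> > 0\<close> by (intro mult_left_mono) auto
    also have "\<dots> = e" by (simp add: \<epsilon>_def)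
    finally show "0 \<le> \<phi> x + e" by simp
  qed
  then show "x \<in> even_power_cone d" by (simp add: even_power_cone_def)
qed

section \<open>Continuity of characters and compactness of the spectrum\<close>

lemma real_characterD:
  assumes "\<alpha> \<in> real_characters"
  shows "linear \<alpha>" "\<alpha> (x * y) = \<alpha> x * \<alpha> y" "\<alpha> 1 = 1" "\<alpha> (of_real r) = r"
  using assms by (auto simp: real_characters_def linear_of_real)

lemma real_character_power: "\<alpha> \<in> real_characters \<Longrightarrow> \<alpha> (x ^ n) = \<alpha> x ^ n"
  by (induction n) (simp_all add: real_characterD)

text \<open>Positivity at \<open>1 + y / N\<close> says \<open>- \<alpha> y \<le> N\<close> as soon
  as \<open>y / N\<close> lies in the \<open>\<delta>\<close>-ball. The least such \<open>N\<close>
  is \<open>norm y / \<delta>\<close>; the extra \<open>e\<close> avoids division by zero and is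
  then removed.\<close>

lemma character_bound:
  assumes \<alpha>: "\<alpha> \<in> real_characters" and nonneg: "\<And>x. x \<in> M \<Longrightarrow> 0 \<le> \<alpha> x"
    and near: "\<And>a. norm a \<le> \<delta> \<Longrightarrow> 1 + a \<in> M" and \<delta>: "\<delta> > 0"
  shows "\<bar>\<alpha> x\<bar> \<le> norm x / \<delta>"
proof -
  have le: "- \<alpha> y \<le> norm y / \<delta>" for y
  proof (rule field_le_epsilon)
    fix e :: real assume e: "0 < e"
    define N where "N = norm y / \<delta> + e"
    have N: "N > 0" using \<delta> e by (simp add: N_def add_nonneg_pos)
    have "norm y \<le> \<delta> * N" using \<delta> e by (simp add: N_def algebra_simps)
    then have "norm ((1 / N) *\<^sub>R y) \<le> \<delta>" using N by (simp add: field_simps)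
    then have "0 \<le> \<alpha> (1 + (1 / N) *\<^sub>R y)" by (intro nonneg near)
    also have "\<dots> = 1 + \<alpha> y / N"
      using real_characterD[OF \<alpha>] by (simp add: linear_add linear_scale)
    finally show "- \<alpha> y \<le> norm y / \<delta> + e" using N by (simp add: N_def field_simps)
  qed
  show ?thesis using le[of x] le[of "-x"] real_characterD(1)[OF \<alpha>] by (simp add: linear_neg)
qed

lemma bounded_character_in_spectrum:
  assumes \<alpha>: "\<alpha> \<in> real_characters" and bound: "\<And>x. \<bar>\<alpha> x\<bar> \<le> norm x * B"
  shows "\<alpha> \<in> gelfand_spectrum"
proof -
  have "bounded_linear \<alpha>"
    using linear_conv_bounded_linear bound real_characterD(1)[OF \<alpha>]
    by (auto simp: bounded_linear_def bounded_linear_axioms_def)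
  then show ?thesis using \<alpha> by (simp add: gelfand_spectrum_def linear_continuous_on)
qed

lemma spectrum_even_power_functional:
  "\<alpha> \<in> gelfand_spectrum \<Longrightarrow> even_power_functional d \<alpha>"
  by (auto simp: gelfand_spectrum_def even_power_functional_def real_characterD real_character_power)

text \<open>The point is uniformity in \<open>\<alpha>\<close>, needed for compactness. A continuous
  character is nonnegative on every even power, so the cone with exponent 2 serves for all.\<close>

lemma spectrum_bound:
  obtains B where "\<And>\<alpha> x. \<alpha> \<in> (gelfand_spectrum :: ('a::{real_normed_algebra, real_algebra_1, comm_ring_1} \<Rightarrow> real) set)
    \<Longrightarrow> \<bar>\<alpha> x\<bar> \<le> norm x * B"
proof -
  obtain \<delta> where \<delta>: "\<delta> > 0" "\<And>a::'a. norm a \<le> \<delta> \<Longrightarrow> 1 + a \<in> even_power_cone 1"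
    using near_one_in_even_power_cone[of 1] by auto
  show thesis
  proof (rule that)
    fix \<alpha> :: "'a \<Rightarrow> real" and x assume \<alpha>: "\<alpha> \<in> gelfand_spectrum"
    then have "\<bar>\<alpha> x\<bar> \<le> norm x / \<delta>"
      using spectrum_even_power_functional[OF \<alpha>, of 1] \<delta>
      by (intro character_bound[where M="even_power_cone 1"]) (auto simp: even_power_cone_def gelfand_spectrum_def)
    then show "\<bar>\<alpha> x\<bar> \<le> norm x * (1 / \<delta>)" by simp
  qed
qed

lemma continuous_on_evaluation: "continuous_on S (\<lambda>\<alpha>::'a \<Rightarrow> 'b::topological_space. \<alpha> x)"
  by (rule continuous_on_subset[OF continuous_on_product_coordinates]) simp

lemma closed_real_characters: "closed (real_characters :: ('a::{real_algebra_1, comm_ring_1} \<Rightarrow> real) set)"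
  unfolding real_characters_def linear_iff
  by (intro closed_Collect_conj closed_Collect_all closed_Collect_eq continuous_intros
      continuous_on_evaluation)

text \<open>Continuity of \<open>\<alpha>\<close> is not visibly a closed condition for pointwise
  convergence. The uniform bound replaces it: the spectrum is the closed set of characters inside a
  Tychonoff box.\<close>

lemma compact_spectrum:
  "compact (gelfand_spectrum :: ('a::{real_normed_algebra, real_algebra_1, comm_ring_1} \<Rightarrow> real) set)"
proof -
  obtain B where B: "\<And>\<alpha> x. \<alpha> \<in> (gelfand_spectrum :: ('a \<Rightarrow> real) set) \<Longrightarrow> \<bar>\<alpha> x\<bar> \<le> norm x * B"
    using spectrum_bound[where 'a='a] by blast
  let ?box = "PiE UNIV (\<lambda>x::'a. {- (norm x * B)..norm x * B})"
  have "(gelfand_spectrum :: ('a \<Rightarrow> real) set) = real_characters \<inter> ?box"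
  proof (intro antisym subsetI)
    fix \<alpha> :: "'a \<Rightarrow> real" assume \<alpha>: "\<alpha> \<in> gelfand_spectrum"
    show "\<alpha> \<in> real_characters \<inter> ?box"
      using \<alpha> B[OF \<alpha>] by (auto simp: gelfand_spectrum_def abs_le_iff minus_le_iff)
  next
    fix \<alpha> assume "\<alpha> \<in> real_characters \<inter> ?box"
    then show "\<alpha> \<in> gelfand_spectrum"
      by (intro bounded_character_in_spectrum[of _ B]) (auto simp: abs_le_iff PiE_iff minus_le_iff)
  qed
  moreover have "compactin (product_topology (\<lambda>_. euclidean) UNIV) ?box"
    unfolding compactin_PiE by simp
  then have "compact ?box" by (simp add: euclidean_product_topology)
  ultimately show ?thesis using closed_real_characters by (metis closed_Int_compact)
qed

lemma functional_nonneg_on_spectrum: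
  fixes L :: "'a::{real_normed_algebra, real_algebra_1, comm_ring_1} \<Rightarrow> real"
  assumes d: "d \<ge> 1" and L: "even_power_functional d L"
    and a: "\<And>\<alpha>. \<alpha> \<in> gelfand_spectrum \<Longrightarrow> 0 \<le> \<alpha> a"
  shows "0 \<le> L a"
proof -
  interpret archimedean_semiring "even_power_cone d :: 'a set"
    by (rule archimedean_semiring_even_power_cone[OF d])
  have "a \<in> even_power_cone d"
  proof (rule ccontr)
    assume "a \<notin> even_power_cone d"
    then obtain \<alpha> where \<alpha>: "\<alpha> \<in> real_characters" "\<And>x. x \<in> even_power_cone d \<Longrightarrow> \<alpha> x \<ge> 0" "\<alpha> a < 0"
      using separating_character by blast
    obtain \<delta> where \<delta>: "\<delta> > 0" "\<And>a::'a. norm a \<le> \<delta> \<Longrightarrow> 1 + a \<in> even_power_cone d"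
      by (rule near_one_in_even_power_cone[where 'a='a, OF d]) blast
    have "\<bar>\<alpha> x\<bar> \<le> norm x * (1 / \<delta>)" for x
      using character_bound[OF \<alpha>(1,2) \<delta>(2,1), of x] by simp
    then have "\<alpha> \<in> gelfand_spectrum" by (rule bounded_character_in_spectrum[OF \<alpha>(1)])
    with a \<alpha>(3) show False by fastforce
  qed
  then show ?thesis using L by (simp add: even_power_cone_def)
qed

subsection \<open>Extension to continuous functions on the spectrum\<close>

text \<open>
  \<^locale>\<open>function_ring_on\<close> requires a Hausdorff type class. The instance for \<^class>\<open>t0_space\<close> is
  needed first, because the library only has the arity induced by the metric on countable products.
\<close>

lemma open_coordinate_vimage: "open U \<Longrightarrow> open {h :: 'a \<Rightarrow> 'b::topological_space. h i \<in> U}"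
  using open_vimage[OF _ continuous_on_product_coordinates[of i]] by (simp add: vimage_def)

instance "fun" :: (type, t0_space) t0_space
proof
  fix f g :: "'a \<Rightarrow> 'b" assume "f \<noteq> g"
  then obtain i where "f i \<noteq> g i" by blast
  then obtain U where U: "open U" "\<not> (f i \<in> U \<longleftrightarrow> g i \<in> U)"
    using t0_space_class.t0_space by metis
  then show "\<exists>U. open U \<and> \<not> (f \<in> U \<longleftrightarrow> g \<in> U)"
    using open_coordinate_vimage[OF U(1), of i] by (intro exI[of _ "{h. h i \<in> U}"]) auto
qed

instance "fun" :: (type, t1_space) t1_space
proof
  fix f g :: "'a \<Rightarrow> 'b" assume "f \<noteq> g"
  then obtain i where "f i \<noteq> g i" by blast
  then obtain U where U: "open U" "f i \<in> U" "g i \<notin> U" using t1_space by blast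
  then show "\<exists>U. open U \<and> f \<in> U \<and> g \<notin> U"
    using open_coordinate_vimage[OF U(1), of i] by (intro exI[of _ "{h. h i \<in> U}"]) auto
qed

instance "fun" :: (type, t2_space) t2_space
proof
  fix f g :: "'a \<Rightarrow> 'b" assume "f \<noteq> g"
  then obtain i where "f i \<noteq> g i" by blast
  then obtain U V where UV: "open U" "open V" "f i \<in> U" "g i \<in> V" "U \<inter> V = {}"
    using hausdorff by metis
  then show "\<exists>U V. open U \<and> open V \<and> f \<in> U \<and> g \<in> V \<and> U \<inter> V = {}"
    using open_coordinate_vimage[OF UV(1), of i] open_coordinate_vimage[OF UV(2), of i]
    by (intro exI[of _ "{h. h i \<in> U}"] exI[of _ "{h. h i \<in> V}"]) auto
qed

lemma Hausdorff_space_euclidean_t2: "Hausdorff_space (euclidean :: 'a::t2_space topology)"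
  unfolding Hausdorff_space_def disjnt_def open_openin[symmetric] by (blast intro: hausdorff)

lemma continuous_on_spectrum_approx:
  fixes f :: "('a::{real_normed_algebra, real_algebra_1, comm_ring_1} \<Rightarrow> real) \<Rightarrow> real"
  assumes "continuous_on gelfand_spectrum f" "e > 0"
  obtains a where "\<And>\<alpha>. \<alpha> \<in> gelfand_spectrum \<Longrightarrow> \<bar>f \<alpha> - \<alpha> a\<bar> \<le> e"
proof -
  let ?K = "gelfand_spectrum :: ('a \<Rightarrow> real) set"
  \<comment> \<open>Agreement with an evaluation is asked on \<open>?K\<close> only, since a sum or
    product of evaluations is again one only at characters.\<close>
  let ?R = "{g. continuous_on ?K g \<and> (\<exists>a. \<forall>\<alpha>\<in>?K. g \<alpha> = \<alpha> a)}"
  have K: "\<alpha> \<in> real_characters" if "\<alpha> \<in> ?K" for \<alpha> using that by (simp add: gelfand_spectrum_def)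
  note D = real_characterD[OF K]
  interpret function_ring_on ?R ?K
  proof
    show "compact ?K" by (rule compact_spectrum)
    show "continuous_on ?K g" if "g \<in> ?R" for g using that by simp
  next
    fix g h assume g: "g \<in> ?R" and h: "h \<in> ?R"
    then obtain a b where ab: "\<And>\<alpha>. \<alpha> \<in> ?K \<Longrightarrow> g \<alpha> = \<alpha> a" "\<And>\<alpha>. \<alpha> \<in> ?K \<Longrightarrow> h \<alpha> = \<alpha> b" by blast
    show "(\<lambda>x. g x + h x) \<in> ?R"
    proof (intro CollectI conjI)
      show "\<exists>c. \<forall>\<alpha>\<in>?K. g \<alpha> + h \<alpha> = \<alpha> c"
        using ab D(1) by (intro exI[of _ "a + b"]) (simp add: linear_add)
    qed (use g h in \<open>auto intro: continuous_intros\<close>)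
    show "(\<lambda>x. g x * h x) \<in> ?R"
    proof (intro CollectI conjI)
      show "\<exists>c. \<forall>\<alpha>\<in>?K. g \<alpha> * h \<alpha> = \<alpha> c"
        using ab D(2) by (intro exI[of _ "a * b"]) simp
    qed (use g h in \<open>auto intro: continuous_intros\<close>)
  next
    show "(\<lambda>_. c) \<in> ?R" for c
    proof (intro CollectI conjI exI ballI)
      show "c = \<alpha> (of_real c)" if "\<alpha> \<in> ?K" for \<alpha> using D(4)[OF that] by (rule sym)
    qed auto
  next
    fix \<alpha> \<beta> :: "'a \<Rightarrow> real" assume "\<alpha> \<noteq> \<beta>"
    then obtain a where "\<alpha> a \<noteq> \<beta> a" by blast
    then show "\<exists>g\<in>?R. g \<alpha> \<noteq> g \<beta>"
      by (intro bexI[of _ "\<lambda>\<gamma>. \<gamma> a"]) (auto intro: continuous_on_evaluation)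
  qed
  obtain g where g: "g \<in> ?R" "\<forall>\<alpha>\<in>?K. \<bar>f \<alpha> - g \<alpha>\<bar> < e"
    using Stone_Weierstrass_basic[OF assms] by blast
  then obtain a where "\<forall>\<alpha>\<in>?K. g \<alpha> = \<alpha> a" by blast
  then show thesis using g(2) by (intro that[of a]) force
qed

text \<open>Everything rests on \<open>near\<close>: uniform approximation of \<open>f\<close> by an
  evaluation at \<open>a\<close> controls \<open>\<Lambda> f\<close> by \<open>L a\<close>. The laws
  for \<open>\<Lambda>\<close> are then inherited from \<open>L\<close> through
  Stone-Weierstrass.\<close>

lemma positive_functional_extension:
  fixes L :: "'a::{real_normed_algebra, real_algebra_1, comm_ring_1} \<Rightarrow> real"
  assumes lin: "linear L"
    and nonneg: "\<And>a. (\<And>\<alpha>. \<alpha> \<in> gelfand_spectrum \<Longrightarrow> 0 \<le> \<alpha> a) \<Longrightarrow> 0 \<le> L a"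
  obtains \<Lambda> where "positive_functional (top_of_set (gelfand_spectrum :: ('a \<Rightarrow> real) set)) \<Lambda>"
    "\<And>a. \<Lambda> (\<lambda>\<alpha>. \<alpha> a) = L a"
proof -
  let ?K = "gelfand_spectrum :: ('a \<Rightarrow> real) set"
  have D: "linear \<alpha>" "\<alpha> (of_real r) = r" if "\<alpha> \<in> ?K" for \<alpha> r
    using that real_characterD[of \<alpha>] by (auto simp: gelfand_spectrum_def)
  have L1: "0 \<le> L 1" using D(2)[of _ 1] by (intro nonneg) simp
  have Lle: "L a \<le> L b + e * L 1" if "\<And>\<alpha>. \<alpha> \<in> ?K \<Longrightarrow> \<alpha> a \<le> \<alpha> b + e" for a b e
  proof -
    have "0 \<le> L (b + of_real e - a)"
    proof (rule nonneg)
      fix \<alpha> assume \<alpha>: "\<alpha> \<in> ?K"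
      show "0 \<le> \<alpha> (b + of_real e - a)"
        using that[OF \<alpha>] D(1)[OF \<alpha>] by (simp add: linear_add linear_diff D(2)[OF \<alpha>])
    qed
    then show ?thesis using lin by (simp add: linear_add linear_diff linear_of_real)
  qed
  \<comment> \<open>An upper envelope gives a value without choosing approximants; by
    \<open>near\<close> this value is forced for continuous \<open>f\<close>.\<close>
  define \<Lambda> where "\<Lambda> f = Inf {L a | a. \<forall>\<alpha>\<in>?K. f \<alpha> \<le> \<alpha> a}" for f :: "('a \<Rightarrow> real) \<Rightarrow> real"
  \<comment> \<open>\<open>a + e\<close> evaluates to at least \<open>f\<close>, and any competitor
    \<open>b\<close> satisfies \<open>\<alpha> a \<le> \<alpha> b + e\<close>. The case
    \<open>e = 0\<close> later shows that \<open>\<Lambda>\<close> extends \<open>L\<close>.\<close>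
  have near: "\<bar>\<Lambda> f - L a\<bar> \<le> e * L 1" if a: "\<And>\<alpha>. \<alpha> \<in> ?K \<Longrightarrow> \<bar>f \<alpha> - \<alpha> a\<bar> \<le> e" for f a e
  proof -
    let ?A = "{L a | a. \<forall>\<alpha>\<in>?K. f \<alpha> \<le> \<alpha> a}"
    have up: "L a + e * L 1 \<in> ?A"
    proof (intro CollectI exI conjI ballI)
      show "L a + e * L 1 = L (a + of_real e)" using lin by (simp add: linear_add linear_of_real)
      show "f \<alpha> \<le> \<alpha> (a + of_real e)" if "\<alpha> \<in> ?K" for \<alpha>
        using a[OF that] D[OF that] by (simp add: linear_add)
    qed
    have low: "L a - e * L 1 \<le> t" if t: "t \<in> ?A" for t
    proof -
      obtain b where b: "t = L b" "\<And>\<alpha>. \<alpha> \<in> ?K \<Longrightarrow> f \<alpha> \<le> \<alpha> b" using t by blast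
      have "L a \<le> L b + e * L 1" using a b(2) by (intro Lle) force
      then show ?thesis using b(1) by simp
    qed
    have "\<Lambda> f \<le> L a + e * L 1"
      unfolding \<Lambda>_def using low by (intro cInf_lower up) (auto simp: bdd_below_def)
    moreover have "L a - e * L 1 \<le> \<Lambda> f"
      unfolding \<Lambda>_def using up low by (intro cInf_greatest) blast+
    ultimately show ?thesis by simp
  qed
  have le_zero: "t \<le> 0" if "\<And>e. e > 0 \<Longrightarrow> t \<le> c * e * L 1" "c \<ge> 0" for t c
  proof (rule field_le_epsilon)
    fix e :: real assume e: "0 < e"
    define \<epsilon> where "\<epsilon> = e / (c * L 1 + 1)"
    have pos: "c * L 1 + 1 > 0" using that(2) L1 by (simp add: add_nonneg_pos)
    have "t \<le> c * \<epsilon> * L 1" using e pos by (intro that) (simp add: \<epsilon>_def)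
    also have "\<dots> \<le> e" using e pos by (simp add: \<epsilon>_def field_simps)
    finally show "t \<le> 0 + e" by simp
  qed
  have "positive_functional (top_of_set ?K) \<Lambda>"
  proof
    show "compact_space (top_of_set ?K)"
      by (simp add: compact_space_subtopology compact_spectrum)
    show "Hausdorff_space (top_of_set ?K)"
      by (intro Hausdorff_space_subtopology Hausdorff_space_euclidean_t2)
  next
    fix f g :: "('a \<Rightarrow> real) \<Rightarrow> real"
    assume "continuous_map (top_of_set ?K) euclideanreal f" "continuous_map (top_of_set ?K) euclideanreal g"
    then have f: "continuous_on ?K f" and g: "continuous_on ?K g" by simp_all
    have "\<bar>\<Lambda> (\<lambda>x. f x + g x) - (\<Lambda> f + \<Lambda> g)\<bar> \<le> 4 * e * L 1" if e: "e > 0" for e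
    proof -
      obtain a where a: "\<And>\<alpha>. \<alpha> \<in> ?K \<Longrightarrow> \<bar>f \<alpha> - \<alpha> a\<bar> \<le> e"
        by (rule continuous_on_spectrum_approx[OF f e]) blast
      obtain b where b: "\<And>\<alpha>. \<alpha> \<in> ?K \<Longrightarrow> \<bar>g \<alpha> - \<alpha> b\<bar> \<le> e"
        by (rule continuous_on_spectrum_approx[OF g e]) blast
      have "\<bar>\<Lambda> (\<lambda>x. f x + g x) - L (a + b)\<bar> \<le> (2 * e) * L 1"
      proof (rule near)
        fix \<alpha> assume "\<alpha> \<in> ?K"
        from a[OF this] b[OF this] D(1)[OF this]
        show "\<bar>f \<alpha> + g \<alpha> - \<alpha> (a + b)\<bar> \<le> 2 * e" by (simp add: linear_add)
      qed
      moreover have "L (a + b) = L a + L b" using lin by (simp add: linear_add)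
      moreover have "\<bar>\<Lambda> f - L a\<bar> \<le> e * L 1" "\<bar>\<Lambda> g - L b\<bar> \<le> e * L 1"
        using a b by (auto intro: near)
      ultimately show ?thesis by linarith
    qed
    then have "\<bar>\<Lambda> (\<lambda>x. f x + g x) - (\<Lambda> f + \<Lambda> g)\<bar> \<le> 0" by (intro le_zero[of _ 4]) auto
    then show "\<Lambda> (\<lambda>x. f x + g x) = \<Lambda> f + \<Lambda> g" by simp
  next
    fix f :: "('a \<Rightarrow> real) \<Rightarrow> real" and c :: real
    assume "continuous_map (top_of_set ?K) euclideanreal f"
    then have f: "continuous_on ?K f" by simp
    have "\<bar>\<Lambda> (\<lambda>x. c * f x) - c * \<Lambda> f\<bar> \<le> (2 * \<bar>c\<bar>) * e * L 1" if e: "e > 0" for e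
    proof -
      obtain a where a: "\<And>\<alpha>. \<alpha> \<in> ?K \<Longrightarrow> \<bar>f \<alpha> - \<alpha> a\<bar> \<le> e"
        by (rule continuous_on_spectrum_approx[OF f e]) blast
      have 1: "\<bar>\<Lambda> (\<lambda>x. c * f x) - L (c *\<^sub>R a)\<bar> \<le> (\<bar>c\<bar> * e) * L 1"
      proof (rule near)
        fix \<alpha> assume \<alpha>: "\<alpha> \<in> ?K"
        have "\<bar>c * f \<alpha> - \<alpha> (c *\<^sub>R a)\<bar> = \<bar>c\<bar> * \<bar>f \<alpha> - \<alpha> a\<bar>"
          using D(1)[OF \<alpha>] by (simp add: linear_scale abs_mult flip: right_diff_distrib)
        then show "\<bar>c * f \<alpha> - \<alpha> (c *\<^sub>R a)\<bar> \<le> \<bar>c\<bar> * e" using a[OF \<alpha>] by (simp add: mult_left_mono)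
      qed
      have "\<bar>c * L a - c * \<Lambda> f\<bar> = \<bar>c\<bar> * \<bar>\<Lambda> f - L a\<bar>"
        by (simp add: abs_mult abs_minus_commute flip: right_diff_distrib)
      also have "\<dots> \<le> \<bar>c\<bar> * (e * L 1)" using near[of f a e] a by (intro mult_left_mono) auto
      finally have 2: "\<bar>c * L a - c * \<Lambda> f\<bar> \<le> \<bar>c\<bar> * e * L 1" by simp
      have 3: "L (c *\<^sub>R a) = c * L a" using lin by (simp add: linear_scale)
      show ?thesis using 1 2 3 by linarith
    qed
    then have "\<bar>\<Lambda> (\<lambda>x. c * f x) - c * \<Lambda> f\<bar> \<le> 0" by (intro le_zero[of _ "2 * \<bar>c\<bar>"]) auto
    then show "\<Lambda> (\<lambda>x. c * f x) = c * \<Lambda> f" by simp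
  next
    fix f :: "('a \<Rightarrow> real) \<Rightarrow> real"
    assume "continuous_map (top_of_set ?K) euclideanreal f"
    then have f: "continuous_on ?K f" by simp
    assume "\<And>x. x \<in> topspace (top_of_set ?K) \<Longrightarrow> 0 \<le> f x"
    then have pos: "0 \<le> f x" if "x \<in> ?K" for x using that by simp
    have "- \<Lambda> f \<le> 2 * e * L 1" if e: "e > 0" for e
    proof -
      obtain a where a: "\<And>\<alpha>. \<alpha> \<in> ?K \<Longrightarrow> \<bar>f \<alpha> - \<alpha> a\<bar> \<le> e"
        by (rule continuous_on_spectrum_approx[OF f e]) blast
      have "L 0 \<le> L a + e * L 1"
      proof (rule Lle)
        fix \<alpha> assume "\<alpha> \<in> ?K"
        from a[OF this] pos[OF this] D(1)[OF this]
        show "\<alpha> 0 \<le> \<alpha> a + e" by (simp add: linear_0)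
      qed
      moreover have "\<bar>\<Lambda> f - L a\<bar> \<le> e * L 1" using a by (rule near)
      ultimately show ?thesis using lin by (simp add: linear_0)
    qed
    then have "- \<Lambda> f \<le> 0" by (intro le_zero[of _ 2]) auto
    then show "0 \<le> \<Lambda> f" by simp
  qed
  moreover have "\<Lambda> (\<lambda>\<alpha>. \<alpha> a) = L a" for a
    using near[of "\<lambda>\<alpha>. \<alpha> a" a 0] by simp
  ultimately show thesis using that by blast
qed

theorem corollary5p4:
  fixes L :: "'a::{real_normed_algebra, real_algebra_1, comm_ring_1} \<Rightarrow> real"
    and d :: nat
  assumes "(real_characters :: ('a \<Rightarrow> real) set) \<noteq> {}"
    and "d \<ge> 1"
    and "linear L"
    and "continuous_on UNIV L"
    and "\<And>a. L (a ^ (2 * d)) \<ge> 0"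
  shows "\<exists>\<mu>. borel_measure_on (gelfand_spectrum :: ('a \<Rightarrow> real) set) \<mu> \<and>
    (\<forall>a. integrable \<mu> (\<lambda>\<alpha>. \<alpha> a) \<and> L a = (\<integral>\<alpha>. \<alpha> a \<partial>\<mu>))"
proof -
  let ?K = "gelfand_spectrum :: ('a \<Rightarrow> real) set"
  have "even_power_functional d L" using assms(3-5) by (simp add: even_power_functional_def)
  then obtain \<Lambda> where \<Lambda>: "positive_functional (top_of_set ?K) \<Lambda>" "\<And>a. \<Lambda> (\<lambda>\<alpha>. \<alpha> a) = L a"
    using positive_functional_extension[OF assms(3)] functional_nonneg_on_spectrum[OF assms(2)] by metis
  interpret positive_functional "top_of_set ?K" \<Lambda> by (rule \<Lambda>(1))
  have cont: "cont (\<lambda>\<alpha>. \<alpha> a)" for a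
    by (simp add: continuous_on_evaluation)
  show ?thesis
  proof (intro exI[of _ representing_measure] conjI allI)
    show "borel_measure_on ?K representing_measure"
      \<comment> \<open>The relatively open sets generate the trace of the ambient Borel
        sets.\<close>
      by (simp add: borel_measure_on_iff_sigma_sets space_representing_measure sets_representing_measure)
    show "integrable representing_measure (\<lambda>\<alpha>. \<alpha> a)" for a by (rule cont_integrable[OF cont])
    show "L a = (\<integral>\<alpha>. \<alpha> a \<partial>representing_measure)" for a
      using functional_eq_integral[OF cont] \<Lambda>(2) by simp
  qed
qed

end
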